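(* Let $K(x;\theta,\phi)=\frac{1}{\sqrt{2\pi}\,x\phi}e^{-(\log x-\theta)^2/(2\phi^2)}$, $x>0$, $\theta\in\mathbb{R}$, $\phi>0$, be the lognormal kernel. Let $\Pi^*$ be a Type I or Type II mixture prior based on this kernel, as defined in the context, satisfying the full support condition (B8) stated there. Let $f_0$ be a continuous density on $[0,\infty)$ satisfying: 1. $f_0$ is nowhere zero except (possibly) at $x=0$ and is bounded above by some $M<\infty$; 2. $\left|\int_0^\infty f_0(x)\log(xf_0(x))\,dx\right|<\infty$; 3. $\int_0^\infty f_0(x)\log\frac{f_0(x)}{\phi_\delta(x)}\,dx<\infty$ for some $\delta>0$, where $\phi_\delta(x)=\inf_{|t-x|<\delta}f_0(t)$, the infimum being over $t$ in the domain of $f_0$; 4. there exists $\eta>0$ such that $\left|\int_0^\infty f_0(x)|\log x|^{2(1+\eta)}\,dx\right|<\infty$. Then $f_0\in\mathrm{KL}(\Pi^* )$.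
   Context: $\mathscr{M}(S)$ is the set of probability measures on $S$; a prior is a probability measure on the indicated space; the weak support of a prior on $\mathscr{M}(S)$ is its support in the topology of weak convergence. Type I mixture prior: $\Pi^*$ is the law of $f_P(x)=\int K(x;\theta,\phi)\,dP(\theta,\phi)$ with $P\sim\Pi$, $\Pi$ a prior on $\mathscr{M}(\mathbb{R}\times(0,\infty))$; condition (B8): the weak support of $\Pi$ is $\mathscr{M}(\mathbb{R}\times(0,\infty))$. Type II mixture prior: $\Pi^*$ is the law of $f_{P,\phi}(x)=\int K(x;\theta,\phi)\,dP(\theta)$ with independent $P\sim\Pi$ and $\phi\sim\mu$, $\Pi$ a prior on $\mathscr{M}(\mathbb{R})$ and $\mu$ a prior on $(0,\infty)$; condition (B8) then means: the weak support of $\Pi$ is $\mathscr{M}(\mathbb{R})$ and the support of $\mu$ is $(0,\infty)$. $f_0\in\mathrm{KL}(\Pi^* )$ means $\Pi^*(\{f:\int f_0\log(f_0/f)<\epsilon\})>0$ for every $\epsilon>0$. *)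

theory Defs
  imports "HOL-Probability.Probability"
begin

abbreviation prob_measures :: "'a::topological_space set \<Rightarrow> 'a measure set" where
  "prob_measures S \<equiv> space (prob_algebra (restrict_space borel S))"

text \<open>The topology of weak convergence on the probability measures on \<open>S\<close>, that is, the coarsest
  topology making \<open>P \<mapsto> \<integral> g dP\<close> continuous for every bounded continuous \<open>g\<close> on \<open>S\<close>. Its carrier
  is all of \<open>prob_measures S\<close> (take \<open>g = 0\<close> and \<open>U = UNIV\<close>).\<close>

definition weak_topology :: "'a::topological_space set \<Rightarrow> 'a measure topology" where
  "weak_topology S = topology_generated_by
     {{P \<in> prob_measures S. integral\<^sup>L P g \<in> U} | (g :: 'a \<Rightarrow> real) U.
        continuous_on S g \<and> bounded (g ` S) \<and> open U}"

definition borel_of :: "'a topology \<Rightarrow> 'a measure" where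
  "borel_of X = sigma (topspace X) {U. openin X U}"

definition is_prior :: "'a topology \<Rightarrow> 'a measure \<Rightarrow> bool" where
  "is_prior X \<rho> \<longleftrightarrow> prob_space \<rho> \<and> sets \<rho> = sets (borel_of X)"

definition measure_support :: "'a topology \<Rightarrow> 'a measure \<Rightarrow> 'a set" where
  "measure_support X \<rho> = {p \<in> topspace X. \<forall>U. openin X U \<and> p \<in> U \<longrightarrow> emeasure \<rho> U > 0}"

text \<open>Probability densities on the positive half-line; values outside \<open>{0<..}\<close> are irrelevant.\<close>

definition pos_densities :: "(real \<Rightarrow> real) set" where
  "pos_densities = {f. f \<in> borel_measurable (restrict_space lborel {0<..}) \<and>
     (\<forall>x>0. 0 \<le> f x) \<and> (\<integral>\<^sup>+x\<in>{0<..}. ennreal (f x) \<partial>lborel) = 1}"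

text \<open>The law of a random density \<open>F\<close> defined on the probability space \<open>M\<close>. No particular
  \<open>\<sigma>\<close>-algebra on densities is singled out; the law lives on the largest one for which \<open>F\<close> is
  measurable, so it extends the law of \<open>F\<close> for any other choice.\<close>

definition density_law :: "'w measure \<Rightarrow> ('w \<Rightarrow> real \<Rightarrow> real) \<Rightarrow> (real \<Rightarrow> real) measure" where
  "density_law M F =
     distr M (sigma pos_densities {A. A \<subseteq> pos_densities \<and> F -` A \<inter> space M \<in> sets M}) F"

definition lognormal_kernel :: "real \<Rightarrow> real \<Rightarrow> real \<Rightarrow> real" where
  "lognormal_kernel x \<theta> \<phi> =
     1 / (sqrt (2 * pi) * x * \<phi>) * exp (- (ln x - \<theta>)\<^sup>2 / (2 * \<phi>\<^sup>2))"

text \<open>In the two mixtures below the integral over the mixing measure may diverge for \<open>x\<close> in a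
  Lebesgue null set; the Bochner integral takes the value 0 there, which does not change the
  density.\<close>

definition mixture_I ::
    "(real \<Rightarrow> real \<Rightarrow> real \<Rightarrow> real) \<Rightarrow> (real \<times> real) measure \<Rightarrow> real \<Rightarrow> real" where
  "mixture_I K P x = (\<integral>p. K x (fst p) (snd p) \<partial>P)"

definition mixture_II ::
    "(real \<Rightarrow> real \<Rightarrow> real \<Rightarrow> real) \<Rightarrow> real measure \<times> real \<Rightarrow> real \<Rightarrow> real" where
  "mixture_II K = (\<lambda>(P, \<phi>) x. \<integral>\<theta>. K x \<theta> \<phi> \<partial>P)"

definition type_I_prior ::
    "(real \<Rightarrow> real \<Rightarrow> real \<Rightarrow> real) \<Rightarrow> (real \<times> real) measure measure \<Rightarrow> (real \<Rightarrow> real) measure" where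
  "type_I_prior K \<rho> = density_law \<rho> (mixture_I K)"

definition type_II_prior ::
    "(real \<Rightarrow> real \<Rightarrow> real \<Rightarrow> real) \<Rightarrow> real measure measure \<Rightarrow> real measure \<Rightarrow> (real \<Rightarrow> real) measure" where
  "type_II_prior K \<rho> \<mu> = density_law (\<rho> \<Otimes>\<^sub>M \<mu>) (mixture_II K)"

text \<open>The integrand \<open>a log (a / b)\<close> for \<open>a, b \<ge> 0\<close>, with the conventions \<open>0 log (0 / b) = 0\<close> and
  \<open>a log (a / 0) = \<infinity>\<close> for \<open>a > 0\<close> (whereas \<open>ln (a / 0) = 0\<close> in the library).\<close>

definition log_ratio_term :: "real \<Rightarrow> real \<Rightarrow> ereal" where
  "log_ratio_term a b = (if a = 0 then 0 else if b = 0 then \<infinity> else ereal (a * ln (a / b)))"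

text \<open>The extended-real integral of \<open>f log (f / g)\<close> over \<open>{0<..}\<close>, as the integral of the positive
  part minus that of the negative part. The latter is finite when \<open>f\<close> and \<open>g\<close> are densities, and
  zero when \<open>g \<le> f\<close>, so that \<open>\<infinity> - \<infinity>\<close> does not arise in these cases.\<close>

definition log_ratio_integral :: "(real \<Rightarrow> real) \<Rightarrow> (real \<Rightarrow> real) \<Rightarrow> ereal" where
  "log_ratio_integral f g =
     enn2ereal (\<integral>\<^sup>+x\<in>{0<..}. e2ennreal (log_ratio_term (f x) (g x)) \<partial>lborel) -
     enn2ereal (\<integral>\<^sup>+x\<in>{0<..}. e2ennreal (- log_ratio_term (f x) (g x)) \<partial>lborel)"

definition in_KL :: "(real \<Rightarrow> real) \<Rightarrow> (real \<Rightarrow> real) measure \<Rightarrow> bool" where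
  "in_KL f0 \<rho> \<longleftrightarrow>
     (\<forall>\<epsilon>>0. emeasure \<rho> {f \<in> space \<rho>. log_ratio_integral f0 f < ereal \<epsilon>} > 0)"

definition local_inf :: "(real \<Rightarrow> real) \<Rightarrow> real \<Rightarrow> real \<Rightarrow> real" where
  "local_inf f \<delta> x = (INF t\<in>{t. 0 \<le> t \<and> \<bar>t - x\<bar> < \<delta>}. f t)"

end

theory Submission
  imports Defs
begin

text \<open>
  In the variable \<open>y = ln x\<close> the lognormal kernel is the normal kernel. So the true density becomes
  \<open>g(y) = exp y * f(exp y)\<close>, the mixtures become normal location-scale mixtures, and the divergence
  does not change, as the Jacobians cancel. The claim is thus about approximating \<open>g\<close> by normal
  mixtures.

  Truncate \<open>g\<close> to \<open>[-m, m]\<close> and convolve it with a normal density of bandwidth \<open>h\<close>. For a mixing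
  measure near this one, the mixture need not be compared with the convolution in both directions:
  a lower bound for the mixture suffices, because the divergence of \<open>f\<close> from a density decreases
  in the latter. Cut \<open>[-m, m]\<close> into short cells; if the mixing measure gives a small open box near each cell almost the mass of the cell, then the mixture is at
  every point at least the convolution of the truncated \<open>g\<close> with a slightly shrunk normal density
  (\<open>charges_boxes_mixture_ge\<close>). The condition on the boxes bounds the masses of finitely many open
  sets from below, which is an open condition in the weak topology. It is satisfied by a discrete
  measure, so it has positive prior probability by the support condition (\<open>weak_prior_charges\<close>). A
  Type II mixture is a Type I mixture whose mixing measure has a degenerate second marginal, which
  allows one argument for both types.

  It remains to let \<open>m \<rightarrow> \<infinity>\<close> with \<open>h = m powr (-\<eta>)\<close>. The lower limit of the smoothed density is at
  least \<open>g\<close> (\<open>smoothing_liminf_ge\<close>, by Fatou's lemma), so the positive part of the logarithmic ratio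
  tends to 0 pointwise. A majorant that is integrable against \<open>f\<close> comes from the remaining
  hypotheses (\<open>ln_ratio_smoothing_le\<close>): for \<open>\<bar>y\<bar> \<le> m\<close> the smoothed density is bounded below by the
  local infimum of \<open>f\<close>, up to factors whose logarithm is linear in \<open>y\<close>; for \<open>\<bar>y\<bar> > m\<close> it is at least
  \<open>exp (-16 * (y / h)^2)\<close> up to a constant, and \<open>(y / h)^2 \<le> \<bar>y\<bar> powr (2 * (1 + \<eta>))\<close> by the choice
  of \<open>h\<close>. Dominated convergence finishes the proof (\<open>exists_smoothing_close\<close>). A remaining point is
  that the Kullback-Leibler neighbourhoods are measurable events, which rests on the joint
  measurability of the mixture in the mixing measure and in \<open>x\<close> (\<open>in_KL_density_law\<close>).
\<close>

section \<open>The weak topology and priors of full support\<close>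

lemma sets_restrict_borel_eq_sigma_sets:
  "sets (restrict_space borel S) = sigma_sets S {S \<inter> U | U. open (U :: 'a::topological_space set)}"
proof -
  have "sets (restrict_space borel S) = {(\<lambda>x. x) -` A \<inter> S | A. A \<in> sigma_sets UNIV {U :: 'a set. open U}}"
    by (auto simp: sets_restrict_space borel_def)
  also have "\<dots> = sigma_sets S {(\<lambda>x. x) -` A \<inter> S | A. A \<in> {U. open U}}"
    by (rule sigma_sets_vimage_commute) auto
  also have "{(\<lambda>x. x) -` A \<inter> S | A. A \<in> {U :: 'a set. open U}} = {S \<inter> U | U. open U}"
    by auto
  finally show ?thesis .
qed

lemma topspace_weak_topology: "topspace (weak_topology S) = prob_measures S"
proof -
  have "prob_measures S = {P \<in> prob_measures S. integral\<^sup>L P (\<lambda>x. 0 :: real) \<in> UNIV}" by auto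
  moreover have "continuous_on S (\<lambda>x. 0 :: real) \<and> bounded ((\<lambda>x. 0 :: real) ` S) \<and> open (UNIV :: real set)"
    by (auto intro!: boundedI[where B=0])
  ultimately have "prob_measures S \<in> {{P \<in> prob_measures S. integral\<^sup>L P g \<in> U} | (g :: 'a \<Rightarrow> real) U.
        continuous_on S g \<and> bounded (g ` S) \<and> open U}"
    by blast
  then show ?thesis
    unfolding weak_topology_def topology_generated_by_topspace by blast
qed

lemma prob_measuresD:
  assumes "P \<in> prob_measures S"
  shows "prob_space P" "sets P = sets (restrict_space borel S)" "space P = S"
  using assms sets_eq_imp_space_eq[of P "restrict_space borel S"]
  by (auto simp: space_prob_algebra space_restrict_space)

text \<open>One half of the portmanteau theorem: \<open>P \<mapsto> P(U)\<close> is lower semicontinuous for open \<open>U\<close>, because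
\<open>P(U)\<close> is the supremum of the integrals of the bounded continuous functions
\<open>min 1 (n * dist(x, -U))\<close>, which increase to the indicator of \<open>U\<close>.\<close>

lemma openin_weak_topology_measure_greater:
  fixes U :: "'a::metric_space set"
  assumes "open U"
  shows "openin (weak_topology S) {P \<in> prob_measures S. c < measure P (S \<inter> U)}"
proof -
  (* the distance to the empty set is 0 in the library, so U = UNIV is treated apart *)
  define g :: "nat \<Rightarrow> 'a \<Rightarrow> real"
    where "g n x = (if U = UNIV then 1 else min 1 (real n * infdist x (- U)))" for n x
  have g_cont: "continuous_on A (g n)" for n A
    unfolding g_def by (cases "U = UNIV") (auto intro!: continuous_intros)
  have g_bounds: "0 \<le> g n x" "g n x \<le> 1" for n x
    by (auto simp: g_def infdist_nonneg)
  have g_le: "g n x \<le> indicator U x" for n x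
    using g_bounds[of n x] by (auto simp: g_def indicator_def)
  have g_lim: "(\<lambda>n. g n x) \<longlonglongrightarrow> indicator U x" for x
  proof (cases "x \<in> U \<and> U \<noteq> UNIV")
    case True
    then have "infdist x (- U) > 0"
      using assms by (intro infdist_pos_not_in_closed) auto
    then obtain N :: nat where N: "1 < real N * infdist x (- U)"
      using ex_less_of_nat_mult by blast
    have "g n x = 1" if "n \<ge> N" for n
    proof -
      have "real N * infdist x (- U) \<le> real n * infdist x (- U)"
        using that by (intro mult_right_mono) (auto simp: infdist_nonneg)
      then show ?thesis using N by (simp add: g_def)
    qed
    then have "eventually (\<lambda>n. g n x = 1) sequentially"
      by (auto simp: eventually_sequentially)
    then show ?thesis using True by (simp add: tendsto_eventually)
  qed (auto simp: g_def intro!: tendsto_eventually)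
  have "{P \<in> prob_measures S. c < measure P (S \<inter> U)} =
    (\<Union>n. {P \<in> prob_measures S. integral\<^sup>L P (g n) \<in> {c<..}})"
  proof -
    have "c < measure P (S \<inter> U) \<longleftrightarrow> (\<exists>n. c < integral\<^sup>L P (g n))" if P: "P \<in> prob_measures S" for P
    proof -
      interpret prob_space P using prob_measuresD[OF P] by simp
      have sets_P: "sets P = sets (restrict_space borel S)" using prob_measuresD[OF P] by simp
      have g_meas: "g n \<in> borel_measurable P" for n
        by (subst measurable_cong_sets[OF sets_P refl])
           (intro borel_measurable_continuous_on_restrict g_cont)
      have U_meas: "indicat_real U \<in> borel_measurable P"
        by (subst measurable_cong_sets[OF sets_P refl])
           (intro measurable_restrict_space1 borel_measurable_indicator, use assms in simp)
      have meas_eq: "integral\<^sup>L P (indicat_real U) = measure P (S \<inter> U)"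
        using prob_measuresD(3)[OF P] by (simp add: Int_commute)
      have int: "integrable P (g n)" for n
        by (rule integrable_const_bound[where B=1]) (use g_bounds g_meas in auto)
      have "(\<lambda>n. integral\<^sup>L P (g n)) \<longlonglongrightarrow> integral\<^sup>L P (indicat_real U)"
        by (rule integral_dominated_convergence[where w="\<lambda>_. 1"])
           (use g_bounds g_meas U_meas g_lim in auto)
      then have lim: "(\<lambda>n. integral\<^sup>L P (g n)) \<longlonglongrightarrow> measure P (S \<inter> U)" unfolding meas_eq .
      have "integral\<^sup>L P (g n) \<le> integral\<^sup>L P (indicat_real U)" for n
      proof (rule integral_mono[OF int])
        show "integrable P (indicat_real U)"
          by (rule integrable_const_bound[where B=1]) (use U_meas in auto)
      qed (rule g_le)
      then have le: "integral\<^sup>L P (g n) \<le> measure P (S \<inter> U)" for n unfolding meas_eq .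
      show ?thesis
      proof
        assume "c < measure P (S \<inter> U)"
        from order_tendstoD(1)[OF lim this] show "\<exists>n. c < integral\<^sup>L P (g n)"
          by (auto simp: eventually_sequentially)
      qed (use le in \<open>auto intro: less_le_trans\<close>)
    qed
    then show ?thesis by auto
  qed
  moreover have "openin (weak_topology S) {P \<in> prob_measures S. integral\<^sup>L P (g n) \<in> {c<..}}" for n
  proof -
    have "bounded (g n ` S)"
      using g_bounds by (auto intro!: boundedI[where B=1])
    then show ?thesis
      unfolding weak_topology_def using g_cont
      by (intro topology_generated_by_Basis CollectI exI[of _ "g n"] exI[of _ "{c<..}"]) auto
  qed
  ultimately show ?thesis by (auto intro!: openin_Union)
qed

lemma openin_borel_of: "openin X U \<Longrightarrow> U \<in> sets (borel_of X)"
  unfolding borel_of_def by (subst sets_measure_of) (auto dest: openin_subset)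

lemma space_borel_of: "space (borel_of X) = topspace X"
  unfolding borel_of_def by (subst space_measure_of) (auto dest: openin_subset)

lemma is_priorD:
  assumes "is_prior X \<rho>"
  shows "prob_space \<rho>" "sets \<rho> = sets (borel_of X)" "space \<rho> = topspace X"
  using assms sets_eq_imp_space_eq[of \<rho> "borel_of X"]
  by (auto simp: is_prior_def space_borel_of)

text \<open>A prior lives on the Borel sets of the weak topology, whereas measurability of integrals in the
mixing measure is known for the \<open>\<sigma>\<close>-algebra generated by the evaluations \<open>P \<mapsto> P(A)\<close>. Every such
evaluation is Borel: for open \<open>A\<close> by lower semicontinuity, and the open sets are a generator that
is closed under intersection.\<close>

lemma weak_prior_measurable:
  fixes \<rho> :: "'a::metric_space measure measure"
  assumes "is_prior (weak_topology S) \<rho>"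
  shows "(\<lambda>P. P) \<in> measurable \<rho> (prob_algebra (restrict_space borel S))"
proof (rule measurable_prob_algebra_generated[OF sets_restrict_borel_eq_sigma_sets])
  have sp: "space \<rho> = prob_measures S"
    using is_priorD(3)[OF assms] by (simp add: topspace_weak_topology)
  show "Int_stable {S \<inter> U | U. open U}"
  proof (rule Int_stableI)
    fix A B assume "A \<in> {S \<inter> U | U. open U}" "B \<in> {S \<inter> U | U. open U}"
    then obtain U V where "A = S \<inter> U" "B = S \<inter> V" "open U" "open V" by auto
    then show "A \<inter> B \<in> {S \<inter> U | U. open U}"
      by (intro CollectI exI[of _ "U \<inter> V"]) auto
  qed
  show "prob_space P" "sets P = sets (restrict_space borel S)" if "P \<in> space \<rho>" for P
    using prob_measuresD(1,2)[of P S] that by (simp_all add: sp)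
  show "(\<lambda>P. emeasure P A) \<in> borel_measurable \<rho>" if AG: "A \<in> {S \<inter> U | U. open U}" for A
  proof -
    obtain U where A: "A = S \<inter> U" "open U" using AG by blast
    have "{P \<in> space \<rho>. c < measure P A} \<in> sets \<rho>" for c
      using openin_borel_of[OF openin_weak_topology_measure_greater[OF A(2), of S c]] A(1)
      by (simp add: sp is_priorD(2)[OF assms])
    then have [measurable]: "(\<lambda>P. measure P A) \<in> borel_measurable \<rho>"
      by (subst borel_measurable_iff_greater) auto
    have "(\<lambda>P. ennreal (measure P A)) \<in> borel_measurable \<rho>" by measurable
    moreover have "ennreal (measure P A) = emeasure P A" if "P \<in> space \<rho>" for P
    proof -
      interpret prob_space P using prob_measuresD that sp by auto
      show ?thesis by (simp add: emeasure_eq_measure)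
    qed
    ultimately show ?thesis by (subst measurable_cong[where g="\<lambda>P. ennreal (measure P A)"]) auto
  qed
qed auto

text \<open>How full support is used: an event that bounds the masses of finitely many open sets from below
is open, hence has positive probability as soon as a single measure \<open>Q\<close> belongs to it.\<close>

lemma weak_prior_charges:
  fixes \<rho> :: "'a::metric_space measure measure"
  assumes prior: "is_prior (weak_topology S) \<rho>"
    and supp: "measure_support (weak_topology S) \<rho> = prob_measures S"
    and Q: "Q \<in> prob_measures S"
    and K: "finite K" "\<And>k. k \<in> K \<Longrightarrow> open (U k)" "\<And>k. k \<in> K \<Longrightarrow> a k < measure Q (S \<inter> U k)"
  shows "0 < emeasure \<rho> {P \<in> space \<rho>. \<forall>k\<in>K. a k < measure P (S \<inter> U k)}"
proof -
  let ?W = "{P \<in> prob_measures S. \<forall>k\<in>K. a k < measure P (S \<inter> U k)}"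
  have "?W = topspace (weak_topology S) \<inter> (\<Inter>k\<in>K. {P \<in> prob_measures S. a k < measure P (S \<inter> U k)})"
    by (auto simp: topspace_weak_topology)
  also have "openin (weak_topology S) \<dots>"
    using K(1,2) by (intro openin_Int_Inter) (auto intro: openin_weak_topology_measure_greater)
  finally have "openin (weak_topology S) ?W" .
  moreover have "Q \<in> ?W" using Q K(3) by auto
  ultimately have "0 < emeasure \<rho> ?W"
    using supp Q unfolding measure_support_def by blast
  then show ?thesis
    using is_priorD(3)[OF prior] by (simp add: topspace_weak_topology)
qed

section \<open>Lognormal mixtures as random densities\<close>

abbreviation half_plane :: "(real \<times> real) set" where
  "half_plane \<equiv> UNIV \<times> {0<..}"

text \<open>The substitution \<open>x = exp t\<close> turns the half-line into the line. It is first made on \<open>[-n, n]\<close>;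
both sides then converge monotonically.\<close>

lemma nn_integral_exp_substitution:
  fixes F :: "real \<Rightarrow> real"
  assumes [measurable]: "F \<in> borel_measurable borel"
  shows "(\<integral>\<^sup>+x\<in>{0<..}. ennreal (F x) \<partial>lborel) = (\<integral>\<^sup>+t. ennreal (F (exp t) * exp t) \<partial>lborel)"
proof -
  have step: "(\<integral>\<^sup>+x. ennreal (F x) * indicator {exp (- real n)..exp (real n)} x \<partial>lborel) =
      (\<integral>\<^sup>+t. ennreal (F (exp t) * exp t) * indicator {- real n..real n} t \<partial>lborel)" for n
  proof -
    have "(\<integral>\<^sup>+x. ennreal (F x) * indicator {exp (- real n)..exp (real n)} x \<partial>lborel) =
        (\<integral>\<^sup>+x. F x * indicator {exp (- real n)..exp (real n)} x \<partial>lborel)"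
      by (intro nn_integral_cong) (simp split: split_indicator)
    also have "\<dots> = (\<integral>\<^sup>+x. F (exp x) * exp x * indicator {- real n..real n} x \<partial>lborel)"
      by (rule nn_integral_substitution)
         (auto intro!: derivative_eq_intros continuous_intros simp: set_borel_measurable_def)
    also have "\<dots> = (\<integral>\<^sup>+t. ennreal (F (exp t) * exp t) * indicator {- real n..real n} t \<partial>lborel)"
      by (intro nn_integral_cong) (simp split: split_indicator)
    finally show ?thesis .
  qed
  have "(\<lambda>n. \<integral>\<^sup>+x. ennreal (F x) * indicator {exp (- real n)..exp (real n)} x \<partial>lborel)
      \<longlonglongrightarrow> (\<integral>\<^sup>+x\<in>{0<..}. ennreal (F x) \<partial>lborel)"
  proof (rule nn_integral_LIMSEQ)
    show "incseq (\<lambda>n x. ennreal (F x) * indicator {exp (- real n)..exp (real n)} x)"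
      by (auto simp: incseq_def le_fun_def intro!: mult_left_mono split: split_indicator)
         (meson exp_le_cancel_iff le_minus_iff minus_le_iff neg_le_iff_le of_nat_mono order_trans)+
    show "(\<lambda>n. ennreal (F x) * indicator {exp (- real n)..exp (real n)} x)
        \<longlonglongrightarrow> ennreal (F x) * indicator {0<..} x" for x
    proof (cases "x > 0")
      case True
      obtain N where N: "\<bar>ln x\<bar> \<le> real N" using real_arch_simple by blast
      have "x \<in> {exp (- real n)..exp (real n)}" if "n \<ge> N" for n
      proof -
        have "- real n \<le> ln x" "ln x \<le> real n" using N that by linarith+
        then have "exp (- real n) \<le> exp (ln x)" "exp (ln x) \<le> exp (real n)" by simp_all
        then show ?thesis using True by simp
      qed
      then show ?thesis using True
        by (intro tendsto_eventually) (auto simp: eventually_sequentially intro!: exI[of _ N])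
    next
      case False
      then have "x \<notin> {exp (- real n)..exp (real n)}" for n
        using exp_gt_zero[of "- real n"] by (auto simp del: exp_gt_zero)
      then have "indicator {exp (- real n)..exp (real n)} x = (0 :: ennreal)" for n
        by (rule indicator_simps)
      then show ?thesis using False by simp
    qed
  qed measurable
  moreover have "(\<lambda>n. \<integral>\<^sup>+t. ennreal (F (exp t) * exp t) * indicator {- real n..real n} t \<partial>lborel)
      \<longlonglongrightarrow> (\<integral>\<^sup>+t. ennreal (F (exp t) * exp t) \<partial>lborel)"
  proof (rule nn_integral_LIMSEQ)
    show "incseq (\<lambda>n t. ennreal (F (exp t) * exp t) * indicator {- real n..real n} t)"
      by (auto simp: incseq_def le_fun_def intro!: mult_left_mono split: split_indicator)
    show "(\<lambda>n. ennreal (F (exp t) * exp t) * indicator {- real n..real n} t)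
        \<longlonglongrightarrow> ennreal (F (exp t) * exp t)" for t
    proof -
      obtain N where N: "\<bar>t\<bar> \<le> real N" using real_arch_simple by blast
      have "t \<in> {- real n..real n}" if "n \<ge> N" for n
        using N that by auto
      then show ?thesis
        by (intro tendsto_eventually) (auto simp: eventually_sequentially intro!: exI[of _ N])
    qed
  qed measurable
  ultimately show ?thesis unfolding step by (rule LIMSEQ_unique)
qed

lemma lognormal_kernel_eq_normal_density:
  assumes "x > 0" "\<phi> > 0"
  shows "lognormal_kernel x \<theta> \<phi> = normal_density \<theta> \<phi> (ln x) / x"
  using assms by (simp add: lognormal_kernel_def normal_density_def real_sqrt_mult)

lemma nn_integral_lognormal_kernel:
  assumes "\<phi> > 0"
  shows "(\<integral>\<^sup>+x\<in>{0<..}. ennreal (lognormal_kernel x \<theta> \<phi>) \<partial>lborel) = 1"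
proof -
  have "(\<integral>\<^sup>+x\<in>{0<..}. ennreal (lognormal_kernel x \<theta> \<phi>) \<partial>lborel) =
      (\<integral>\<^sup>+t. ennreal (lognormal_kernel (exp t) \<theta> \<phi> * exp t) \<partial>lborel)"
    by (rule nn_integral_exp_substitution) (unfold lognormal_kernel_def, measurable)
  also have "\<dots> = (\<integral>\<^sup>+t. ennreal (normal_density \<theta> \<phi> t) \<partial>lborel)"
    using assms by (simp add: lognormal_kernel_eq_normal_density)
  also have "\<dots> = 1"
    using assms by (simp add: nn_integral_eq_integral integral_normal_density)
  finally show ?thesis .
qed

lemma measurable_fst_snd_half_plane:
  "fst \<in> measurable (restrict_space borel half_plane) borel"
  "snd \<in> measurable (restrict_space borel half_plane) borel"
  by (auto intro!: measurable_restrict_space1 borel_measurable_continuous_onI continuous_intros)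

lemma measurable_lognormal_kernel_half_plane:
  "(\<lambda>(x, p). ennreal (lognormal_kernel x (fst p) (snd p)))
     \<in> borel_measurable (borel \<Otimes>\<^sub>M restrict_space borel half_plane)"
proof -
  note [measurable] = measurable_fst_snd_half_plane
  show ?thesis unfolding lognormal_kernel_def by measurable
qed

text \<open>The mixture as an integral with values in \<open>[0, \<infinity>]\<close>. Unlike the Bochner integral in
\<^const>\<open>mixture_I\<close>, it can be compared with lower bounds without any integrability condition.\<close>

definition mixture_nn :: "(real \<times> real) measure \<Rightarrow> real \<Rightarrow> ennreal" where
  "mixture_nn P x = (\<integral>\<^sup>+p. ennreal (lognormal_kernel x (fst p) (snd p)) \<partial>P)"

lemma mixture_I_eq_mixture_nn:
  assumes P: "P \<in> prob_measures half_plane" and "x > 0"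
  shows "mixture_I lognormal_kernel P x = enn2real (mixture_nn P x)"
proof -
  note sets_P = prob_measuresD(2)[OF P] and sp = prob_measuresD(3)[OF P]
  note [measurable] = measurable_fst_snd_half_plane
  have [measurable]: "(\<lambda>p. lognormal_kernel x (fst p) (snd p)) \<in> borel_measurable P"
    by (subst measurable_cong_sets[OF sets_P refl]) (unfold lognormal_kernel_def, measurable)
  have "AE p in P. 0 \<le> lognormal_kernel x (fst p) (snd p)"
    using assms(2) by (intro AE_I2) (auto simp: sp lognormal_kernel_def)
  then show ?thesis
    unfolding mixture_I_def mixture_nn_def by (intro integral_eq_nn_integral) auto
qed

lemma measurable_mixture_nn:
  assumes "L \<in> measurable M (prob_algebra (restrict_space borel half_plane))"
  shows "(\<lambda>(\<omega>, x). mixture_nn (L \<omega>) x) \<in> borel_measurable (M \<Otimes>\<^sub>M borel)"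
proof -
  note [measurable] = measurable_prob_algebraD[OF assms] measurable_lognormal_kernel_half_plane
  have "(\<lambda>z. \<integral>\<^sup>+p. (case (snd z, p) of (x, p) \<Rightarrow> ennreal (lognormal_kernel x (fst p) (snd p))) \<partial>L (fst z))
      \<in> borel_measurable (M \<Otimes>\<^sub>M borel)"
    by (rule nn_integral_measurable_subprob_algebra2[where N="restrict_space borel half_plane"]) measurable
  then show ?thesis by (simp add: mixture_nn_def split_beta')
qed

lemma mixture_nn_measurable:
  assumes P: "P \<in> prob_measures half_plane"
  shows "mixture_nn P \<in> borel_measurable borel"
proof -
  have "(\<lambda>(P, x). mixture_nn P x) \<in>
      borel_measurable (prob_algebra (restrict_space borel half_plane) \<Otimes>\<^sub>M borel)"
    by (rule measurable_mixture_nn) simp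
  from measurable_compose[OF measurable_Pair1'[OF P] this] show ?thesis
    by (simp add: comp_def)
qed

lemma nn_integral_mixture_nn:
  assumes P: "P \<in> prob_measures half_plane"
  shows "(\<integral>\<^sup>+x\<in>{0<..}. mixture_nn P x \<partial>lborel) = 1"
proof -
  note sets_P = prob_measuresD(2)[OF P] and sp = prob_measuresD(3)[OF P]
  interpret prob_space P using prob_measuresD(1)[OF P] .
  interpret pair_sigma_finite P lborel ..
  have [measurable]: "(\<lambda>(x, p). ennreal (lognormal_kernel x (fst p) (snd p))) \<in> borel_measurable (borel \<Otimes>\<^sub>M P)"
    by (subst measurable_cong_sets[OF sets_pair_measure_cong[OF refl sets_P] refl])
       (rule measurable_lognormal_kernel_half_plane)
  have "(\<integral>\<^sup>+x\<in>{0<..}. mixture_nn P x \<partial>lborel) =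
      (\<integral>\<^sup>+x. \<integral>\<^sup>+p. ennreal (lognormal_kernel x (fst p) (snd p)) * indicator {0<..} x \<partial>P \<partial>lborel)"
    unfolding mixture_nn_def by (intro nn_integral_cong) (simp add: nn_integral_multc)
  also have "\<dots> = (\<integral>\<^sup>+p. \<integral>\<^sup>+x. ennreal (lognormal_kernel x (fst p) (snd p)) * indicator {0<..} x \<partial>lborel \<partial>P)"
    by (rule Fubini') measurable
  also have "\<dots> = (\<integral>\<^sup>+p. 1 \<partial>P)"
    by (intro nn_integral_cong) (auto simp: sp nn_integral_lognormal_kernel)
  finally show ?thesis by (simp add: emeasure_space_1)
qed

text \<open>The mixture integrates to 1 by Tonelli's theorem, so it is finite almost everywhere. Hence
replacing the value \<open>\<infinity>\<close> by 0 does not change the density.\<close>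

lemma AE_mixture_nn_finite:
  assumes P: "P \<in> prob_measures half_plane"
  shows "AE x in lborel. x > 0 \<longrightarrow> mixture_nn P x < \<infinity>"
proof -
  note [measurable] = mixture_nn_measurable[OF P]
  have "AE x in lborel. mixture_nn P x * indicator {0<..} x \<noteq> \<infinity>"
    by (rule nn_integral_PInf_AE) (simp_all add: nn_integral_mixture_nn[OF P])
  then show ?thesis by eventually_elim (auto simp: less_top)
qed

lemma mixture_in_pos_densities:
  assumes P: "P \<in> prob_measures half_plane"
    and F: "\<And>x. x > 0 \<Longrightarrow> F x = enn2real (mixture_nn P x)"
  shows "F \<in> pos_densities"
proof -
  note [measurable] = mixture_nn_measurable[OF P]
  have "F \<in> borel_measurable (restrict_space lborel {0<..})"
    by (subst measurable_cong[where g="\<lambda>x. enn2real (mixture_nn P x)"])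
       (auto simp: F space_restrict_space intro!: measurable_restrict_space1)
  moreover have "(\<integral>\<^sup>+x\<in>{0<..}. ennreal (F x) \<partial>lborel) = (\<integral>\<^sup>+x\<in>{0<..}. mixture_nn P x \<partial>lborel)"
    using AE_mixture_nn_finite[OF P]
    by (intro nn_integral_cong_AE, eventually_elim) (auto simp: F split: split_indicator)
  ultimately show ?thesis
    by (simp add: pos_densities_def nn_integral_mixture_nn[OF P] F)
qed

lemma log_ratio_integral_cong:
  assumes "\<And>x. x > 0 \<Longrightarrow> f x = f' x" "\<And>x. x > 0 \<Longrightarrow> g x = g' x"
  shows "log_ratio_integral f g = log_ratio_integral f' g'"
proof -
  have *: "h (log_ratio_term (f x) (g x)) * indicator {0<..} x =
      h (log_ratio_term (f' x) (g' x)) * indicator {0<..} x" for x :: real and h :: "ereal \<Rightarrow> ennreal"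
    using assms by (auto split: split_indicator)
  show ?thesis
    unfolding log_ratio_integral_def *[of e2ennreal] *[of "\<lambda>z. e2ennreal (- z)"] ..
qed

lemma log_ratio_term_measurable [measurable (raw)]:
  assumes [measurable]: "f \<in> borel_measurable M" "g \<in> borel_measurable M"
  shows "(\<lambda>x. log_ratio_term (f x) (g x)) \<in> borel_measurable M"
  unfolding log_ratio_term_def by measurable

text \<open>The Kullback-Leibler neighbourhood is measurable for the law of the random density, because
\<open>(\<omega>, x) \<mapsto> f\<^sub>\<omega>(x)\<close> is jointly measurable. It therefore has positive probability if it
contains an event of positive probability. Both types of mixture prior are covered through the
random mixing measure \<open>L\<close> on the half-plane of pairs \<open>(\<theta>, \<phi>)\<close>.\<close>

lemma in_KL_density_law:
  assumes L: "L \<in> measurable M (prob_algebra (restrict_space borel half_plane))"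
    and F: "\<And>\<omega> x. \<omega> \<in> space M \<Longrightarrow> x > 0 \<Longrightarrow> F \<omega> x = mixture_I lognormal_kernel (L \<omega>) x"
    and f: "f \<in> borel_measurable borel"
    and E: "\<And>\<epsilon>. \<epsilon> > 0 \<Longrightarrow> \<exists>E\<in>sets M. 0 < emeasure M E \<and>
      (\<forall>\<omega>\<in>E. log_ratio_integral f (\<lambda>x. enn2real (mixture_nn (L \<omega>) x)) < ereal \<epsilon>)"
  shows "in_KL f (density_law M F)"
  unfolding in_KL_def
proof (intro allI impI)
  fix \<epsilon> :: real assume "\<epsilon> > 0"
  have LP: "L \<omega> \<in> prob_measures half_plane" if "\<omega> \<in> space M" for \<omega>
    using measurable_space[OF L that] .
  have F': "F \<omega> x = enn2real (mixture_nn (L \<omega>) x)" if "\<omega> \<in> space M" "x > 0" for \<omega> x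
    using F[OF that] mixture_I_eq_mixture_nn[OF LP] that by simp
  have F_pos: "F \<in> space M \<rightarrow> pos_densities"
    using F' LP mixture_in_pos_densities by blast
  let ?A = "{A. A \<subseteq> pos_densities \<and> F -` A \<inter> space M \<in> sets M}"
  interpret sigma_algebra pos_densities ?A
  proof (rule sigma_algebra_iff2[THEN iffD2], safe)
    fix A assume "F -` A \<inter> space M \<in> sets M"
    then have "space M - (F -` A \<inter> space M) \<in> sets M" by auto
    also have "space M - (F -` A \<inter> space M) = F -` (pos_densities - A) \<inter> space M"
      using F_pos by auto
    finally show "F -` (pos_densities - A) \<inter> space M \<in> sets M" .
  next
    fix A :: "nat \<Rightarrow> (real \<Rightarrow> real) set" assume A: "range A \<subseteq> ?A"
    have "F -` (\<Union> (range A)) \<inter> space M = (\<Union>i. F -` A i \<inter> space M)" by blast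
    moreover have "\<dots> \<in> sets M" using A by (intro sets.countable_UN) auto
    ultimately show "F -` (\<Union> (range A)) \<inter> space M \<in> sets M"
      by simp
  qed auto
  have F_meas: "F \<in> measurable M (sigma pos_densities ?A)"
    using F_pos by (intro measurableI) auto
  let ?B = "{g \<in> pos_densities. log_ratio_integral f g < ereal \<epsilon>}"
  have eq: "log_ratio_integral f (F \<omega>) = log_ratio_integral f (\<lambda>x. enn2real (mixture_nn (L \<omega>) x))"
    if "\<omega> \<in> space M" for \<omega>
    using F' that by (intro log_ratio_integral_cong) auto
  have preimage: "F -` ?B \<inter> space M =
      {\<omega>\<in>space M. log_ratio_integral f (\<lambda>x. enn2real (mixture_nn (L \<omega>) x)) < ereal \<epsilon>}"
    using F_pos eq by auto
  note [measurable] = f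
  have [measurable]: "(\<lambda>(\<omega>, x). mixture_nn (L \<omega>) x) \<in> borel_measurable (M \<Otimes>\<^sub>M lborel)"
    using measurable_mixture_nn[OF L] by simp
  have "(\<lambda>\<omega>. log_ratio_integral f (\<lambda>x. enn2real (mixture_nn (L \<omega>) x))) \<in> borel_measurable M"
    unfolding log_ratio_integral_def by measurable
  then have "F -` ?B \<inter> space M \<in> sets M"
    unfolding preimage by measurable
  then have B: "?B \<in> ?A" by auto
  from E[OF \<open>\<epsilon> > 0\<close>] obtain E where E: "E \<in> sets M" "0 < emeasure M E"
      "\<forall>\<omega>\<in>E. log_ratio_integral f (\<lambda>x. enn2real (mixture_nn (L \<omega>) x)) < ereal \<epsilon>"
    by blast
  have "0 < emeasure M E" by fact
  also have "\<dots> \<le> emeasure M (F -` ?B \<inter> space M)"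
  proof (rule emeasure_mono)
    show "E \<subseteq> F -` ?B \<inter> space M"
      unfolding preimage using E(3) sets.sets_into_space[OF E(1)] by blast
  qed (use B in blast)
  also have "\<dots> = emeasure (density_law M F) ?B"
    unfolding density_law_def by (rule emeasure_distr[symmetric, OF F_meas]) (use B in simp)
  also have "?B = {g \<in> space (density_law M F). log_ratio_integral f g < ereal \<epsilon>}"
    by (simp add: density_law_def)
  finally show "0 < emeasure (density_law M F) {g \<in> space (density_law M F). log_ratio_integral f g < ereal \<epsilon>}" .
qed

section \<open>A lower bound for mixtures that charge finitely many boxes\<close>

lemma box_in_sets:
  assumes "s \<le> h"
  shows "ball \<theta> s \<times> ball h s \<subseteq> half_plane"
    "ball \<theta> s \<times> ball h s \<in> sets (restrict_space borel half_plane)"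
proof -
  show sub: "ball \<theta> s \<times> ball h s \<subseteq> half_plane"
    using assms by (auto simp: dist_real_def)
  have "ball \<theta> s \<times> ball h s \<in> sets borel" by (intro borel_open open_Times) auto
  moreover have "half_plane \<in> sets borel" by (intro borel_open open_Times) auto
  ultimately show "ball \<theta> s \<times> ball h s \<in> sets (restrict_space borel half_plane)"
    using sub by (auto simp: sets_restrict_space_iff)
qed

text \<open>The only consequence of the support condition that the approximation needs. The centres all have
the same second coordinate \<open>h\<close>, since in a Type II mixture all components share one bandwidth.
The lower bounds \<open>a\<close> are those that some distribution \<open>Q\<close> of the first coordinate exceeds with
atoms at the centres.\<close>

definition charges_boxes :: "'w measure \<Rightarrow> ('w \<Rightarrow> (real \<times> real) measure) \<Rightarrow> bool" where
  "charges_boxes M L \<longleftrightarrow>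
     (\<forall>Q K a h s. prob_space Q \<and> sets Q = sets borel \<and> finite K \<and> 0 < s \<and> s \<le> h \<and>
        (\<forall>\<theta>\<in>K. 0 \<le> a \<theta> \<and> a \<theta> < measure Q {\<theta>}) \<longrightarrow>
        0 < emeasure M {\<omega> \<in> space M. \<forall>\<theta>\<in>K. a \<theta> < measure (L \<omega>) (ball \<theta> s \<times> ball h s)})"

text \<open>Take \<open>\<theta>'\<close> within \<open>h * e\<close> of \<open>\<theta>\<close> and \<open>\<sigma>\<close> between \<open>h * (1 - e)\<close> and \<open>h * (1 + e)\<close>. The normal
density at \<open>y\<close> with mean \<open>\<theta>'\<close> and standard deviation \<open>\<sigma>\<close> is smallest when each occurrence of
\<open>\<theta>'\<close> and \<open>\<sigma>\<close> takes its worst value; the result, as a function of \<open>u = y - \<theta>\<close>, is this lower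
envelope. All margins are proportional to \<open>h\<close>, so that the envelope is a function of \<open>u / h\<close>
divided by \<open>h\<close>, just as a normal density is.\<close>

definition shrunk_normal :: "real \<Rightarrow> real \<Rightarrow> real \<Rightarrow> real" where
  "shrunk_normal h e u = exp (- ((\<bar>u\<bar> + h * e) / (h * (1 - e)))\<^sup>2 / 2) / (sqrt (2 * pi) * (h * (1 + e)))"

lemma shrunk_normal_measurable [measurable]: "shrunk_normal h e \<in> borel_measurable borel"
  unfolding shrunk_normal_def by measurable

lemma normal_density_ge_on_box:
  fixes h e \<sigma> u v :: real
  assumes "0 < h" "0 < e" "e < 1" "h * (1 - e) \<le> \<sigma>" "\<sigma> \<le> h * (1 + e)" "\<bar>u\<bar> \<le> v"
  shows "exp (- (v / (h * (1 - e)))\<^sup>2 / 2) / (sqrt (2 * pi) * (h * (1 + e))) \<le>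
    exp (- u\<^sup>2 / (2 * \<sigma>\<^sup>2)) / (sqrt (2 * pi) * \<sigma>)"
proof (rule frac_le)
  have pos: "0 < h * (1 - e)" using assms by simp
  then have "0 < \<sigma>" using assms(4) by linarith
  have "\<bar>u\<bar> / \<sigma> \<le> v / (h * (1 - e))"
    using assms pos by (intro frac_le) auto
  then have "(\<bar>u\<bar> / \<sigma>)\<^sup>2 \<le> (v / (h * (1 - e)))\<^sup>2"
    using \<open>0 < \<sigma>\<close> by (intro power_mono) auto
  then have "u\<^sup>2 / \<sigma>\<^sup>2 \<le> (v / (h * (1 - e)))\<^sup>2"
    by (simp add: power_divide)
  then show "exp (- (v / (h * (1 - e)))\<^sup>2 / 2) \<le> exp (- u\<^sup>2 / (2 * \<sigma>\<^sup>2))"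
    by (simp add: field_simps)
  show "0 < sqrt (2 * pi) * \<sigma>" using \<open>0 < \<sigma>\<close> by simp
  show "sqrt (2 * pi) * \<sigma> \<le> sqrt (2 * pi) * (h * (1 + e))"
    using assms(5) by simp
qed auto

text \<open>Discretisation. The line is cut into cells of length \<open>d\<close>, and \<open>Q\<close> moves the mass of \<open>\<nu>\<close> in each
cell to its left end point. If the mixing measure gives each of the finitely many disjoint boxes
around these points almost as much mass as \<open>Q\<close> does, then the sum of the contributions of the
boxes to the mixture dominates the \<open>\<nu>\<close>-mixture of the lower envelope over \<open>[-m, m]\<close>,
simultaneously for all \<open>x\<close>: within a cell and its box, the envelope at \<open>t\<close> is below the normal density at the
mixing parameters.\<close>

lemma charges_boxes_mixture_ge:
  assumes charges: "charges_boxes M L"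
    and L: "\<And>\<omega>. \<omega> \<in> space M \<Longrightarrow> L \<omega> \<in> prob_measures half_plane"
    and \<nu>: "prob_space \<nu>" "sets \<nu> = sets borel"
    and h: "0 < h" and e: "0 < e" "e < 1"
  shows "\<exists>E\<in>sets M. 0 < emeasure M E \<and> (\<forall>\<omega>\<in>E. \<forall>x>0.
    ennreal (1 / x) * (ennreal (1 - e) * (\<integral>\<^sup>+t\<in>{- m..m}. ennreal (shrunk_normal h e (ln x - t)) \<partial>\<nu>))
      \<le> mixture_nn (L \<omega>) x)"
proof -
  interpret \<nu>: prob_space \<nu> by fact
  (* s + d < h * e, so that box and cell together move the mean by less than h * e;
     s is at most half the mesh d, so that the boxes are disjoint *)
  define d where "d = h * e / 2"
  define s where "s = d / 2"
  have d: "0 < d" "0 < s" "s \<le> h" "s < d" "s \<le> h * e"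
    using h e by (auto simp: d_def s_def)
  define c :: "real \<Rightarrow> real" where "c t = d * of_int \<lfloor>t / d\<rfloor>" for t
  have c_meas [measurable]: "c \<in> borel_measurable borel" unfolding c_def by measurable
  have c_near: "\<bar>t - c t\<bar> \<le> d" for t
  proof -
    have "of_int \<lfloor>t / d\<rfloor> * d \<le> t" "t < (of_int \<lfloor>t / d\<rfloor> + 1) * d"
      using d(1) by (auto intro: floor_divide_lower floor_divide_upper)
    then show ?thesis by (simp add: c_def algebra_simps)
  qed
  define Q where "Q = distr \<nu> borel c"
  have c_\<nu> [measurable]: "c \<in> measurable \<nu> borel"
    by (subst measurable_cong_sets[OF \<nu>(2) refl]) (rule c_meas)
  interpret Q: prob_space Q unfolding Q_def by (rule \<nu>.prob_space_distr) (rule c_\<nu>)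
  define w where "w \<theta> = measure Q {\<theta>}" for \<theta>
  define K0 where "K0 = (\<lambda>k. d * of_int k) ` {\<lfloor>- m / d\<rfloor>..\<lfloor>m / d\<rfloor>}"
  (* a strict lower bound (1 - e) * w \<theta> for the mass is only attainable where w \<theta> > 0 *)
  define K where "K = {\<theta> \<in> K0. 0 < w \<theta>}"
  have fin: "finite K0" "finite K" by (auto simp: K0_def K_def)
  have c_K0: "c t \<in> K0" if "t \<in> {- m..m}" for t
  proof -
    have "- m / d \<le> t / d" "t / d \<le> m / d"
      using that d(1) by (auto intro!: divide_right_mono simp del: divide_minus_left)
    then show ?thesis
      unfolding c_def K0_def by (intro imageI) (simp add: floor_mono del: divide_minus_left)
  qed
  have sep: "d \<le> \<bar>\<theta> - \<theta>'\<bar>" if "\<theta> \<in> K0" "\<theta>' \<in> K0" "\<theta> \<noteq> \<theta>'" for \<theta> \<theta>'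
  proof -
    obtain j k :: int where jk: "\<theta> = d * of_int j" "\<theta>' = d * of_int k"
      using \<open>\<theta> \<in> K0\<close> \<open>\<theta>' \<in> K0\<close> by (auto simp: K0_def)
    then have "1 \<le> \<bar>j - k\<bar>" using \<open>\<theta> \<noteq> \<theta>'\<close> by auto
    then have "1 \<le> \<bar>real_of_int j - real_of_int k\<bar>" by linarith
    then have "d * 1 \<le> d * \<bar>real_of_int j - real_of_int k\<bar>"
      using d(1) by (intro mult_left_mono) auto
    then show ?thesis
      using d(1) by (simp add: jk abs_mult flip: right_diff_distrib)
  qed
  define box where "box \<theta> = ball \<theta> s \<times> ball h s" for \<theta> :: real
  define E where "E = {\<omega> \<in> space M. \<forall>\<theta>\<in>K. (1 - e) * w \<theta> < measure (L \<omega>) (box \<theta>)}"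
  have "0 < emeasure M E"
    using charges[unfolded charges_boxes_def, rule_format, of Q K s h "\<lambda>\<theta>. (1 - e) * w \<theta>"]
      Q.prob_space_axioms fin d e unfolding E_def box_def
    by (auto simp: Q_def K_def w_def)
  moreover from this have "E \<in> sets M" using emeasure_notin_sets by fastforce
  moreover have "ennreal (1 / x) * (ennreal (1 - e) *
      (\<integral>\<^sup>+t\<in>{- m..m}. ennreal (shrunk_normal h e (ln x - t)) \<partial>\<nu>)) \<le> mixture_nn (L \<omega>) x"
    if "\<omega> \<in> E" "x > 0" for \<omega> x
  proof -
    define y where "y = ln x"
    define b where "b \<theta> = exp (- ((\<bar>y - \<theta>\<bar> + d) / (h * (1 - e)))\<^sup>2 / 2) /
      (sqrt (2 * pi) * (h * (1 + e)))" for \<theta>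
    have b_nonneg: "0 \<le> b \<theta>" for \<theta> using h e by (simp add: b_def)
    let ?P = "L \<omega>"
    have P: "?P \<in> prob_measures half_plane" using L that by (auto simp: E_def)
    note sets_P = prob_measuresD(2)[OF P]
    interpret P: prob_space ?P using prob_measuresD(1)[OF P] .
    have box_sets [measurable]: "box \<theta> \<in> sets ?P" for \<theta>
      unfolding sets_P box_def by (rule box_in_sets(2)[OF \<open>s \<le> h\<close>])
    have kernel_ge: "b \<theta> / x \<le> lognormal_kernel x (fst p) (snd p)" if "p \<in> box \<theta>" for \<theta> p
    proof -
      have p: "\<bar>\<theta> - fst p\<bar> < s" "\<bar>h - snd p\<bar> < s"
        using that by (auto simp: box_def dist_real_def)
      have "b \<theta> \<le> exp (- (y - fst p)\<^sup>2 / (2 * (snd p)\<^sup>2)) / (sqrt (2 * pi) * snd p)"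
        unfolding b_def using p d h e
        by (intro normal_density_ge_on_box) (auto simp: algebra_simps)
      then have "b \<theta> / x \<le> exp (- (y - fst p)\<^sup>2 / (2 * (snd p)\<^sup>2)) / (sqrt (2 * pi) * snd p) / x"
        using \<open>x > 0\<close> by (intro divide_right_mono) auto
      then show ?thesis by (simp add: lognormal_kernel_def y_def mult_ac)
    qed
    have shrunk_le: "shrunk_normal h e (y - t) \<le> b (c t)" for t
    proof -
      have le: "\<bar>y - c t\<bar> + d \<le> \<bar>y - t\<bar> + h * e"
        using c_near[of t] by (auto simp: d_def abs_if split: if_splits)
      then have "((\<bar>y - c t\<bar> + d) / (h * (1 - e)))\<^sup>2 \<le> ((\<bar>y - t\<bar> + h * e) / (h * (1 - e)))\<^sup>2"
        using d h e by (intro power_mono divide_right_mono) auto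
      then show ?thesis
        unfolding shrunk_normal_def b_def using h e by (intro divide_right_mono) auto
    qed
    have "(\<integral>\<^sup>+t\<in>{- m..m}. ennreal (shrunk_normal h e (y - t)) \<partial>\<nu>) \<le>
        (\<integral>\<^sup>+t. (\<Sum>\<theta>\<in>K0. ennreal (b \<theta>) * indicator {\<theta>} (c t)) \<partial>\<nu>)"
    proof (rule nn_integral_mono)
      fix t
      show "ennreal (shrunk_normal h e (y - t)) * indicator {- m..m} t \<le>
          (\<Sum>\<theta>\<in>K0. ennreal (b \<theta>) * indicator {\<theta>} (c t))"
      proof (cases "t \<in> {- m..m}")
        case True
        have "ennreal (shrunk_normal h e (y - t)) \<le> ennreal (b (c t)) * indicator {c t} (c t)"
          using shrunk_le by (simp add: ennreal_leI)
        also have "\<dots> \<le> (\<Sum>\<theta>\<in>K0. ennreal (b \<theta>) * indicator {\<theta>} (c t))"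
          by (rule member_le_sum) (use c_K0[OF True] fin in auto)
        finally show ?thesis using True by simp
      qed simp
    qed
    also have "\<dots> = (\<Sum>\<theta>\<in>K0. ennreal (b \<theta>) * (\<integral>\<^sup>+t. indicator {\<theta>} (c t) \<partial>\<nu>))"
      by (subst nn_integral_sum) (auto simp: nn_integral_cmult)
    also have "\<dots> = (\<Sum>\<theta>\<in>K0. ennreal (b \<theta> * w \<theta>))"
    proof (rule sum.cong[OF refl])
      fix \<theta>
      have "(\<integral>\<^sup>+t. indicator {\<theta>} (c t) \<partial>\<nu>) = (\<integral>\<^sup>+z. indicator {\<theta>} z \<partial>Q)"
        unfolding Q_def by (subst nn_integral_distr) auto
      also have "\<dots> = emeasure Q {\<theta>}" by (rule nn_integral_indicator) (simp add: Q_def)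
      finally show "ennreal (b \<theta>) * (\<integral>\<^sup>+t. indicator {\<theta>} (c t) \<partial>\<nu>) = ennreal (b \<theta> * w \<theta>)"
        using b_nonneg by (simp add: Q.emeasure_eq_measure w_def ennreal_mult)
    qed
    also have "\<dots> = (\<Sum>\<theta>\<in>K. ennreal (b \<theta> * w \<theta>))"
    proof (rule sum.mono_neutral_right)
      show "\<forall>\<theta>\<in>K0 - K. ennreal (b \<theta> * w \<theta>) = 0"
      proof
        fix \<theta> assume "\<theta> \<in> K0 - K"
        then have "w \<theta> = 0"
          using measure_nonneg[of Q "{\<theta>}"] by (auto simp: K_def w_def)
        then show "ennreal (b \<theta> * w \<theta>) = 0" by simp
      qed
    qed (auto simp: fin K_def)
    finally have upper: "(\<integral>\<^sup>+t\<in>{- m..m}. ennreal (shrunk_normal h e (y - t)) \<partial>\<nu>) \<le>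
        (\<Sum>\<theta>\<in>K. ennreal (b \<theta> * w \<theta>))" .
    have "ennreal (1 / x) * (ennreal (1 - e) *
        (\<integral>\<^sup>+t\<in>{- m..m}. ennreal (shrunk_normal h e (y - t)) \<partial>\<nu>)) \<le>
        ennreal (1 / x) * (ennreal (1 - e) * (\<Sum>\<theta>\<in>K. ennreal (b \<theta> * w \<theta>)))"
      by (intro mult_left_mono upper) auto
    also have "\<dots> = (\<Sum>\<theta>\<in>K. ennreal (b \<theta> / x) * ennreal ((1 - e) * w \<theta>))"
      unfolding sum_distrib_left
    proof (rule sum.cong[OF refl])
      fix \<theta>
      have "0 \<le> w \<theta>" by (simp add: w_def)
      then show "ennreal (1 / x) * (ennreal (1 - e) * ennreal (b \<theta> * w \<theta>)) =
          ennreal (b \<theta> / x) * ennreal ((1 - e) * w \<theta>)"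
        using b_nonneg[of \<theta>] e \<open>x > 0\<close> by (simp flip: ennreal_mult add: mult_ac)
    qed
    also have "\<dots> \<le> (\<Sum>\<theta>\<in>K. ennreal (b \<theta> / x) * emeasure ?P (box \<theta>))"
      using \<open>\<omega> \<in> E\<close>
      by (intro sum_mono mult_left_mono) (auto simp: E_def P.emeasure_eq_measure intro!: ennreal_leI less_imp_le)
    also have "\<dots> = (\<integral>\<^sup>+p. (\<Sum>\<theta>\<in>K. ennreal (b \<theta> / x) * indicator (box \<theta>) p) \<partial>?P)"
      by (subst nn_integral_sum) (auto simp: nn_integral_cmult)
    also have "\<dots> \<le> mixture_nn ?P x"
      unfolding mixture_nn_def
    proof (rule nn_integral_mono)
      fix p
      show "(\<Sum>\<theta>\<in>K. ennreal (b \<theta> / x) * indicator (box \<theta>) p) \<le>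
          ennreal (lognormal_kernel x (fst p) (snd p))"
      proof (cases "\<exists>\<theta>\<in>K. p \<in> box \<theta>")
        case True
        then obtain \<theta> where \<theta>: "\<theta> \<in> K" "p \<in> box \<theta>" by blast
        have "p \<notin> box \<theta>'" if "\<theta>' \<in> K" "\<theta>' \<noteq> \<theta>" for \<theta>'
        proof
          assume "p \<in> box \<theta>'"
          then have "\<bar>\<theta> - \<theta>'\<bar> < 2 * s" using \<theta>(2) by (auto simp: box_def dist_real_def)
          moreover have "d \<le> \<bar>\<theta> - \<theta>'\<bar>" using sep \<theta>(1) that by (auto simp: K_def)
          ultimately show False by (simp add: s_def)
        qed
        then have "(\<Sum>\<theta>'\<in>K. ennreal (b \<theta>' / x) * indicator (box \<theta>') p) =
            (\<Sum>\<theta>'\<in>K. if \<theta>' = \<theta> then ennreal (b \<theta> / x) else 0)"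
          using \<theta>(2) by (intro sum.cong) auto
        also have "\<dots> = ennreal (b \<theta> / x)" using \<theta>(1) fin by simp
        also have "\<dots> \<le> ennreal (lognormal_kernel x (fst p) (snd p))"
          using kernel_ge[OF \<theta>(2)] by (rule ennreal_leI)
        finally show ?thesis .
      qed simp
    qed
    finally show ?thesis by (simp add: y_def)
  qed
  ultimately show ?thesis by blast
qed

section \<open>Lower bounds for the smoothed density\<close>

text \<open>The lower bound that the discretisation provides for the density of \<open>ln X\<close> under the mixture,
when \<open>g\<close> is the density of \<open>ln X\<close> under the true distribution.\<close>

definition smoothing :: "(real \<Rightarrow> real) \<Rightarrow> real \<Rightarrow> real \<Rightarrow> real \<Rightarrow> real \<Rightarrow> ennreal" where
  "smoothing g h e m y =
     ennreal (1 - e) * (\<integral>\<^sup>+t\<in>{- m..m}. ennreal (g t * shrunk_normal h e (y - t)) \<partial>lborel)"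

lemma shrunk_normal_nonneg: "0 < h \<Longrightarrow> 0 < e \<Longrightarrow> 0 \<le> shrunk_normal h e u"
  by (simp add: shrunk_normal_def)

lemma smoothing_measurable:
  assumes [measurable]: "g \<in> borel_measurable borel"
  shows "smoothing g h e m \<in> borel_measurable borel"
  unfolding smoothing_def by measurable

lemma smoothing_finite:
  assumes g: "g \<in> borel_measurable borel" "\<And>t. 0 \<le> g t" "(\<integral>\<^sup>+t. ennreal (g t) \<partial>lborel) = 1"
    and h: "0 < h" and e: "0 < e"
  shows "smoothing g h e m y < \<infinity>"
proof -
  note [measurable] = g(1)
  define B where "B = 1 / (sqrt (2 * pi) * (h * (1 + e)))"
  have "shrunk_normal h e u \<le> B" for u
    unfolding shrunk_normal_def B_def using h e by (intro divide_right_mono) auto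
  then have "(\<integral>\<^sup>+t\<in>{- m..m}. ennreal (g t * shrunk_normal h e (y - t)) \<partial>lborel) \<le>
      (\<integral>\<^sup>+t. ennreal B * ennreal (g t) \<partial>lborel)"
    using g(2) shrunk_normal_nonneg[OF h e]
    by (intro nn_integral_mono)
       (auto split: split_indicator simp: mult.commute[of B] intro!: ennreal_leI mult_left_mono simp flip: ennreal_mult'')
  also have "\<dots> < \<infinity>" by (simp add: nn_integral_cmult g(3))
  finally show ?thesis
    unfolding smoothing_def by (simp add: ennreal_mult_less_top less_top)
qed

text \<open>After the substitution \<open>t = y + h * z\<close> the integrand converges pointwise to \<open>g(y)\<close> times the
standard normal density in \<open>z\<close>, and Fatou's lemma gives the bound. Only this one-sided limit is
needed: a lower bound for the mixture is an upper bound for the divergence.\<close>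

lemma smoothing_liminf_ge:
  fixes h e m :: "nat \<Rightarrow> real"
  assumes g: "continuous_on UNIV g" "\<And>t. 0 \<le> g t"
    and e: "\<And>n. 0 < e n" "\<And>n. e n < 1" "e \<longlonglongrightarrow> 0"
    and h: "\<And>n. 0 < h n" "h \<longlonglongrightarrow> 0"
    and m: "filterlim m at_top sequentially"
  shows "ennreal (g y) \<le> liminf (\<lambda>n. smoothing g (h n) (e n) (m n) y)"
proof -
  have [measurable]: "g \<in> borel_measurable borel"
    using g(1) by (rule borel_measurable_continuous_onI)
  (* h times the envelope at h * z, which does not depend on h *)
  define k where "k e z = exp (- ((\<bar>z\<bar> + e) / (1 - e))\<^sup>2 / 2) / (sqrt (2 * pi) * (1 + e))" for e z :: real
  define F where "F n z = ennreal ((1 - e n) * (indicator {- m n..m n} (y + h n * z) * g (y + h n * z) * k (e n) z))"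
    for n z
  have [measurable]: "F n \<in> borel_measurable lborel" for n
    unfolding F_def k_def by measurable
  have rescale: "smoothing g (h n) (e n) (m n) y = (\<integral>\<^sup>+z. F n z \<partial>lborel)" for n
  proof -
    have k: "h n * shrunk_normal (h n) (e n) (y - (y + h n * z)) = k (e n) z" for z
    proof -
      have "(\<bar>h n * z\<bar> + h n * e n) / (h n * (1 - e n)) = (\<bar>z\<bar> + e n) / (1 - e n)"
        using h(1)[of n] by (simp add: abs_mult flip: distrib_left)
      then show ?thesis using h(1)[of n] by (simp add: shrunk_normal_def k_def)
    qed
    define G where "G z = ennreal (g (y + h n * z) * shrunk_normal (h n) (e n) (y - (y + h n * z))) *
        indicator {- m n..m n} (y + h n * z)" for z
    have [measurable]: "G \<in> borel_measurable borel" unfolding G_def by measurable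
    have "smoothing g (h n) (e n) (m n) y = ennreal (1 - e n) * (ennreal \<bar>h n\<bar> *
        (\<integral>\<^sup>+z. G z \<partial>lborel))"
      unfolding smoothing_def G_def using h(1)[of n]
      by (subst nn_integral_real_affine[where c="h n" and t=y]) simp_all
    also have "\<dots> = (\<integral>\<^sup>+z. ennreal (1 - e n) * (ennreal \<bar>h n\<bar> * G z) \<partial>lborel)"
      by (simp add: nn_integral_cmult)
    also have "\<dots> = (\<integral>\<^sup>+z. F n z \<partial>lborel)"
    proof (rule nn_integral_cong)
      fix z
      have "F n z = ennreal ((1 - e n) * (h n * (g (y + h n * z) *
          shrunk_normal (h n) (e n) (y - (y + h n * z)))) * indicator {- m n..m n} (y + h n * z))"
        unfolding F_def k[symmetric] by (simp add: mult_ac)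
      also have "\<dots> = ennreal (1 - e n) * (ennreal \<bar>h n\<bar> * G z)" unfolding G_def
        using e(1,2)[of n] h(1)[of n] g(2)[of "y + h n * z"] shrunk_normal_nonneg[OF h(1) e(1), of n n "y - (y + h n * z)"]
        by (auto simp: ennreal_mult less_imp_le split: split_indicator)
      finally show "ennreal (1 - e n) * (ennreal \<bar>h n\<bar> * G z) = F n z" by simp
    qed
    finally show ?thesis .
  qed
  have F_lim: "(\<lambda>n. F n z) \<longlonglongrightarrow> ennreal (g y * std_normal_density z)" for z
  proof -
    have arg: "(\<lambda>n. y + h n * z) \<longlonglongrightarrow> y"
      using h(2) by (auto intro!: tendsto_eq_intros)
    have "isCont g y" using g(1) by (simp add: continuous_on_eq_continuous_at)
    then have g_lim: "(\<lambda>n. g (y + h n * z)) \<longlonglongrightarrow> g y"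
      using arg by (rule isCont_tendsto_compose)
    have "eventually (\<lambda>n. \<bar>y\<bar> + 1 \<le> m n) sequentially"
      using m by (simp add: filterlim_at_top)
    moreover have "eventually (\<lambda>n. dist (y + h n * z) y < 1) sequentially"
      using arg by (rule tendstoD) simp
    ultimately have "eventually (\<lambda>n. indicator {- m n..m n} (y + h n * z) = (1 :: real)) sequentially"
      by eventually_elim (simp add: dist_real_def indicator_def abs_less_iff, linarith)
    then have ind_lim: "(\<lambda>n. indicator {- m n..m n} (y + h n * z) :: real) \<longlonglongrightarrow> 1"
      by (rule tendsto_eventually)
    have k_lim: "(\<lambda>n. k (e n) z) \<longlonglongrightarrow> std_normal_density z"
      unfolding k_def using e(3)
      by (auto intro!: tendsto_eq_intros simp: std_normal_density_def)
    have "(\<lambda>n. (1 - e n) * (indicator {- m n..m n} (y + h n * z) * g (y + h n * z) * k (e n) z))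
        \<longlonglongrightarrow> (1 - 0) * (1 * g y * std_normal_density z)"
      by (intro tendsto_intros e(3) ind_lim g_lim k_lim)
    then show ?thesis unfolding F_def by (intro tendsto_ennrealI) simp
  qed
  have "ennreal (g y) = ennreal (g y) * (\<integral>\<^sup>+z. ennreal (std_normal_density z) \<partial>lborel)"
    by (simp add: nn_integral_eq_integral)
  also have "\<dots> = (\<integral>\<^sup>+z. ennreal (g y * std_normal_density z) \<partial>lborel)"
    using g(2) by (simp add: ennreal_mult nn_integral_cmult)
  also have "\<dots> = (\<integral>\<^sup>+z. liminf (\<lambda>n. F n z) \<partial>lborel)"
    using F_lim by (intro nn_integral_cong lim_imp_Liminf[symmetric]) auto
  also have "\<dots> \<le> liminf (\<lambda>n. \<integral>\<^sup>+z. F n z \<partial>lborel)"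
    by (rule nn_integral_liminf) measurable
  finally show ?thesis unfolding rescale .
qed

text \<open>For \<open>e \<le> 1/2\<close> the exponent of the envelope is at least \<open>-(2 * v + 1)^2 / 2 \<ge> -4 * v^2 - 1\<close>, and
its normalising constant is at most \<open>3 * (3/2) * h\<close>.\<close>

lemma shrunk_normal_ge:
  assumes h: "0 < h" and e: "0 < e" "e \<le> 1 / 2" and v: "\<bar>u\<bar> \<le> h * v"
  shows "exp (- 4 * v\<^sup>2 - 1) / (5 * h) \<le> shrunk_normal h e u"
  unfolding shrunk_normal_def
proof (rule frac_le)
  have "0 \<le> h * v" using v by linarith
  then have v0: "0 \<le> v" using h by (simp add: zero_le_mult_iff)
  have "(\<bar>u\<bar> + h * e) / (h * (1 - e)) \<le> (h * v + h * (1 / 2)) / (h * (1 / 2))"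
    using h e v v0 by (intro frac_le add_mono mult_left_mono) auto
  also have "\<dots> = 2 * v + 1" using h by (simp add: field_simps)
  finally have "((\<bar>u\<bar> + h * e) / (h * (1 - e)))\<^sup>2 \<le> (2 * v + 1)\<^sup>2"
    using h e by (intro power_mono) auto
  also have "\<dots> \<le> 8 * v\<^sup>2 + 2"
    using zero_le_power2[of "2 * v - 1"] by (simp add: power2_eq_square algebra_simps)
  finally show "exp (- 4 * v\<^sup>2 - 1) \<le> exp (- ((\<bar>u\<bar> + h * e) / (h * (1 - e)))\<^sup>2 / 2)"
    by simp
  have "sqrt (2 * pi) \<le> 3"
    using pi_less_4 by (intro real_le_lsqrt) auto
  then have "sqrt (2 * pi) * (h * (1 + e)) \<le> 3 * (h * (3 / 2))"
    using h e by (intro mult_mono) auto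
  then show "sqrt (2 * pi) * (h * (1 + e)) \<le> 5 * h" using h by linarith
  show "0 < sqrt (2 * pi) * (h * (1 + e))" using h e by simp
qed auto

lemma smoothing_ge_on_interval:
  assumes h: "0 < h" and e: "0 < e" "e \<le> 1 / 2"
    and J: "p \<le> q" "- m \<le> p" "q \<le> m" and b: "0 \<le> b" "\<And>t. p \<le> t \<Longrightarrow> t \<le> q \<Longrightarrow> b \<le> g t"
    and v: "\<And>t. p \<le> t \<Longrightarrow> t \<le> q \<Longrightarrow> \<bar>y - t\<bar> \<le> h * v"
  shows "ennreal (b * (q - p) * exp (- 4 * v\<^sup>2 - 1) / (10 * h)) \<le> smoothing g h e m y"
proof -
  define r where "r = exp (- 4 * v\<^sup>2 - 1) / (5 * h)"
  have r0: "0 \<le> r" using h by (simp add: r_def)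
  have "ennreal (b * (q - p) * exp (- 4 * v\<^sup>2 - 1) / (10 * h)) = ennreal (1 / 2 * (b * r * (q - p)))"
    by (simp add: r_def field_simps)
  also have "\<dots> = ennreal (1 / 2) * ennreal (b * r * (q - p))"
    using b r0 J by (intro ennreal_mult) auto
  also have "ennreal (b * r * (q - p)) = ennreal (b * r) * ennreal (q - p)"
    using b r0 J by (intro ennreal_mult) auto
  also have "\<dots> = (\<integral>\<^sup>+t. ennreal (b * r) * indicator {p..q} t \<partial>lborel)"
    using J by (simp add: nn_integral_cmult_indicator)
  also have "ennreal (1 / 2) * \<dots> \<le> smoothing g h e m y"
    unfolding smoothing_def
  proof (rule mult_mono, goal_cases)
    case 2
    show ?case
    proof (rule nn_integral_mono)
      fix t
      have "b * r \<le> g t * shrunk_normal h e (y - t)" if "p \<le> t" "t \<le> q"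
        unfolding r_def using b shrunk_normal_ge[OF h e v] that h
        by (intro mult_mono) (auto intro: order_trans[OF b(1)])
      then show "ennreal (b * r) * indicator {p..q} t \<le>
          ennreal (g t * shrunk_normal h e (y - t)) * indicator {- m..m} t"
        using J by (auto split: split_indicator intro!: ennreal_leI)
    qed
  next
    case 1
    then show ?case using e by (intro ennreal_leI) auto
  qed auto
  finally show ?thesis .
qed

text \<open>Inside the truncation interval the smoothing loses at most a factor proportional to \<open>a\<close> against
the infimum \<open>b\<close> of \<open>g\<close> at distance \<open>a\<close>, uniformly in the bandwidth \<open>h\<close>: the envelope is of
size \<open>1 / h\<close> on an interval of length \<open>h * a\<close>. That interval is placed on the side of \<open>y\<close>
that faces 0, because it has to stay inside the truncation interval.\<close>

lemma smoothing_ge_near: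
  assumes h: "0 < h" "h \<le> 1" and e: "0 < e" "e \<le> 1 / 2"
    and y: "\<bar>y\<bar> \<le> m" "1 \<le> m" and a: "0 < a" "a \<le> 1"
    and b: "0 \<le> b" "\<And>t. \<bar>y - t\<bar> \<le> a \<Longrightarrow> b \<le> g t"
  shows "ennreal (exp (- 5) / 10 * a * b) \<le> smoothing g h e m y"
proof -
  have ha: "0 < h * a" "h * a \<le> a" "h * a \<le> 1"
    using h a by (auto simp: mult_le_cancel_right1 mult_le_one)
  define p where "p = (if y \<ge> 0 then y - h * a else y)"
  have A: "ennreal (b * (p + h * a - p) * exp (- 4 * a\<^sup>2 - 1) / (10 * h)) \<le> smoothing g h e m y"
    using ha y by (intro smoothing_ge_on_interval h e b) (auto simp: p_def abs_if split: if_splits)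
  have B: "exp (- 5) / 10 * a * b \<le> b * (p + h * a - p) * exp (- 4 * a\<^sup>2 - 1) / (10 * h)"
  proof -
    have "a\<^sup>2 \<le> 1" using a by (simp add: power_le_one)
    then have "exp (- 5) \<le> exp (- 4 * a\<^sup>2 - 1)" by simp
    then have "exp (- 5) * (a * b / 10) \<le> exp (- 4 * a\<^sup>2 - 1) * (a * b / 10)"
      using a b by (intro mult_right_mono) auto
    then show ?thesis using h by (simp add: field_simps)
  qed
  show ?thesis by (rule order_trans[OF ennreal_leI[OF B] A])
qed

text \<open>Outside the truncation interval only a lower bound for \<open>g\<close> on \<open>[-1, 1]\<close> is used. The price is a
Gaussian tail in \<open>y / h\<close>, which the moment condition pays for.\<close>

lemma smoothing_ge_far:
  assumes h: "0 < h" "h \<le> 1" and e: "0 < e" "e \<le> 1 / 2"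
    and y: "1 \<le> \<bar>y\<bar>" and m: "1 \<le> m"
    and b: "0 \<le> b" "\<And>t. \<bar>t\<bar> \<le> 1 \<Longrightarrow> b \<le> g t"
  shows "ennreal (b / 5 * exp (- 16 * (y / h)\<^sup>2 - 1)) \<le> smoothing g h e m y"
proof -
  define v where "v = 2 * \<bar>y\<bar> / h"
  have A: "ennreal (b * (1 - (- 1)) * exp (- 4 * v\<^sup>2 - 1) / (10 * h)) \<le> smoothing g h e m y"
  proof (rule smoothing_ge_on_interval[OF h(1) e])
    show "\<bar>y - t\<bar> \<le> h * v" if "- 1 \<le> t" "t \<le> 1" for t
      using that y h by (simp add: v_def)
  qed (use m b in auto)
  have B: "b / 5 * exp (- 16 * (y / h)\<^sup>2 - 1) \<le> b * (1 - (- 1)) * exp (- 4 * v\<^sup>2 - 1) / (10 * h)"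
  proof -
    define E where "E = exp (- 16 * (y / h)\<^sup>2 - 1)"
    have E: "exp (- 4 * v\<^sup>2 - 1) = E"
      unfolding E_def v_def by (simp add: power_divide power_mult_distrib)
    have "0 \<le> E" by (simp add: E_def)
    then have "b / 5 * E * h \<le> b / 5 * E * 1"
      using b(1) h(2) by (intro mult_left_mono) auto
    then have "b / 5 * E \<le> b / 5 * E / h"
      using h(1) by (simp only: pos_le_divide_eq mult_1_right)
    also have "\<dots> = b * (1 - (- 1)) * E / (10 * h)" by simp
    finally show ?thesis unfolding E E_def .
  qed
  show ?thesis by (rule order_trans[OF ennreal_leI[OF B] A])
qed

section \<open>Convergence of the smoothed density in divergence\<close>

lemma local_inf_le:
  assumes "\<And>t. 0 \<le> f t" "0 \<le> t" "\<bar>t - x\<bar> < \<delta>"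
  shows "local_inf f \<delta> x \<le> f t"
  unfolding local_inf_def using assms by (intro cINF_lower bdd_belowI2[where m=0]) auto

lemma local_inf_nonneg:
  assumes "\<And>t. 0 \<le> f t" "0 < \<delta>" "0 \<le> x"
  shows "0 \<le> local_inf f \<delta> x"
  unfolding local_inf_def using assms by (intro cINF_greatest) (auto intro!: exI[of _ x])

text \<open>As an infimum over the points at distance less than \<open>\<delta>\<close>, the local infimum is upper
semicontinuous on the half-line: its strict sublevel sets are unions of open intervals.\<close>

lemma local_inf_measurable:
  assumes f: "\<And>t. 0 \<le> f t" and \<delta>: "0 < \<delta>"
  shows "(\<lambda>x. if 0 < x then local_inf f \<delta> x else 0) \<in> borel_measurable borel"
proof (subst borel_measurable_iff_less, intro allI)
  fix c
  have "{x. 0 < x \<and> local_inf f \<delta> x < c} = {0<..} \<inter> (\<Union>t\<in>{t. 0 \<le> t \<and> f t < c}. {t - \<delta><..<t + \<delta>})"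
  proof -
    have "local_inf f \<delta> x < c \<longleftrightarrow> (\<exists>t. 0 \<le> t \<and> \<bar>t - x\<bar> < \<delta> \<and> f t < c)" if "0 < x" for x
      unfolding local_inf_def using that f \<delta>
      by (subst cINF_less_iff) (auto intro!: bdd_belowI2[where m=0] exI[of _ x])
    then show ?thesis by (auto simp: abs_less_iff) (metis add.commute less_diff_eq diff_less_eq)+
  qed
  also have "\<dots> \<in> sets borel" by (intro borel_open open_Int open_UN) auto
  finally have "{x. 0 < x \<and> local_inf f \<delta> x < c} \<in> sets borel" .
  moreover have "{x \<in> space borel. (if 0 < x then local_inf f \<delta> x else 0) < c} =
      {x. 0 < x \<and> local_inf f \<delta> x < c} \<union> (if 0 < c then {..0} else {})"
    by (auto split: if_splits)
  ultimately show "{x \<in> space borel. (if 0 < x then local_inf f \<delta> x else 0) < c} \<in> sets borel"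
    by auto
qed

text \<open>The \<open>\<delta>\<close>-neighbourhood of \<open>x = exp y\<close> contains the image of an interval around \<open>y\<close> whose length
\<open>a\<close> is of order \<open>\<delta> / x\<close> for large \<open>x\<close>. Since \<open>- ln a\<close> grows only linearly in \<open>y = ln x\<close>, it
is integrable under the moment condition.\<close>

lemma exp_near:
  assumes a: "a = min 1 (\<delta> / (4 * exp y))" and \<delta>: "0 < \<delta>" and t: "\<bar>y - t\<bar> \<le> a"
  shows "\<bar>exp t - exp y\<bar> < (\<delta> :: real)" "exp (y - 1) \<le> exp t"
proof -
  have "\<bar>t - y\<bar> \<le> 1" "\<bar>t - y\<bar> \<le> \<delta> / (4 * exp y)" using a t by auto
  then have "2 * \<bar>t - y\<bar> * exp y < \<delta>" using \<delta> by (simp add: field_simps)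
  moreover have "\<bar>exp (t - y) - 1\<bar> \<le> 2 * \<bar>t - y\<bar>"
  proof (cases "t - y \<ge> 0")
    case True
    have "exp (t - y) \<le> 1 + (t - y) + (t - y)\<^sup>2"
      using True \<open>\<bar>t - y\<bar> \<le> 1\<close> by (intro exp_bound) auto
    also have "(t - y)\<^sup>2 \<le> (t - y) * 1"
      unfolding power2_eq_square using True \<open>\<bar>t - y\<bar> \<le> 1\<close> by (intro mult_left_mono) auto
    finally show ?thesis using True by simp
  next
    case False
    define E where "E = exp (t - y)"
    have "E \<le> 1" "1 + (t - y) \<le> E" using False by (auto simp: E_def)
    then have "\<bar>E - 1\<bar> \<le> \<bar>t - y\<bar>" by simp
    then have "\<bar>E - 1\<bar> \<le> 2 * \<bar>t - y\<bar>"
      unfolding mult_2 by (rule add_increasing2[OF abs_ge_zero])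
    then show ?thesis by (simp add: E_def)
  qed
  moreover have "\<bar>exp t - exp y\<bar> = \<bar>exp (t - y) - 1\<bar> * exp y"
  proof -
    have "exp t - exp y = (exp (t - y) - 1) * exp y"
      by (simp add: left_diff_distrib flip: exp_add)
    then show ?thesis by (simp add: abs_mult)
  qed
  ultimately show "\<bar>exp t - exp y\<bar> < \<delta>"
    by (smt (verit) exp_gt_zero mult_right_mono)
  show "exp (y - 1) \<le> exp t" using \<open>\<bar>t - y\<bar> \<le> 1\<close> by simp
qed

text \<open>The integrable majorant for the logarithmic ratio, uniform in the truncation level \<open>m\<close>. For
\<open>\<bar>ln x\<bar> \<le> m\<close> the ratio is controlled by the local infimum of \<open>f\<close>. For \<open>\<bar>ln x\<bar> > m\<close> the
Gaussian tail contributes \<open>(y / h)^2\<close> with \<open>y = ln x\<close>; the bandwidth \<open>h = m powr (-\<eta>)\<close> is chosen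
such that \<open>1 / h < \<bar>y\<bar> powr \<eta>\<close> there, which turns the tail into the moment of order
\<open>2 * (1 + \<eta>)\<close>.\<close>

lemma ln_ratio_smoothing_le:
  assumes f: "continuous_on UNIV f" "\<And>t. 0 \<le> f t" "\<And>t. 0 < t \<Longrightarrow> 0 < f t"
    and int: "(\<integral>\<^sup>+x\<in>{0<..}. ennreal (f x) \<partial>lborel) = 1"
    and \<eta>: "0 < \<eta>" and \<delta>: "0 < \<delta>"
    and g: "\<And>t. g t = exp t * f (exp t)"
  shows "\<exists>C\<ge>0. \<forall>m\<ge>2. \<forall>x>0. 0 < local_inf f \<delta> x \<longrightarrow>
    0 < enn2real (smoothing g (m powr - \<eta>) (1 / m) m (ln x)) \<and>
    ln (x * f x / enn2real (smoothing g (m powr - \<eta>) (1 / m) m (ln x))) \<le>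
      C + ln (f x / local_inf f \<delta> x) + \<bar>ln (x * f x)\<bar> + 17 * \<bar>ln x\<bar> powr (2 * (1 + \<eta>))"
proof -
  have f_meas [measurable]: "f \<in> borel_measurable borel"
    using f(1) by (rule borel_measurable_continuous_onI)
  have g_meas: "g \<in> borel_measurable borel" unfolding g[abs_def] by measurable
  have g_nonneg: "0 \<le> g t" for t by (simp add: g f(2))
  have "(\<integral>\<^sup>+t. ennreal (g t) \<partial>lborel) = 1"
    using nn_integral_exp_substitution[OF f_meas] int by (simp add: g mult.commute)
  note finite = smoothing_finite[OF g_meas g_nonneg this]
  have "continuous_on {-1..1} g"
    unfolding g[abs_def] using f(1)
    by (intro continuous_intros continuous_on_compose2[OF f(1)]) auto
  from continuous_attains_inf[OF _ _ this]
  obtain t0 where t0: "t0 \<in> {-1..1}" "\<And>t. t \<in> {-1..1} \<Longrightarrow> g t0 \<le> g t" by auto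
  define b0 where "b0 = g t0"
  have b0: "0 < b0" "\<And>t. \<bar>t\<bar> \<le> 1 \<Longrightarrow> b0 \<le> g t"
    using t0(2) f(3) by (auto simp: b0_def g[of t0]) (auto simp: g abs_le_iff)
  define c :: real where "c = exp (- 5) / 10"
  have c: "0 < c" by (simp add: c_def)
  define C where "C = \<bar>ln c\<bar> + \<bar>ln (\<delta> / 4)\<bar> + \<bar>ln (b0 / 5)\<bar> + 2"
  define p where "p = 2 * (1 + \<eta>)"
  have "0 \<le> C" by (simp add: C_def)
  moreover have "0 < enn2real (smoothing g (m powr - \<eta>) (1 / m) m (ln x)) \<and>
    ln (x * f x / enn2real (smoothing g (m powr - \<eta>) (1 / m) m (ln x))) \<le>
      C + ln (f x / local_inf f \<delta> x) + \<bar>ln (x * f x)\<bar> + 17 * \<bar>ln x\<bar> powr p"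
    if m: "2 \<le> m" and x: "0 < x" and L: "0 < local_inf f \<delta> x" for m x
  proof -
    define y where "y = ln x"
    have exp_y: "exp y = x" using x by (simp add: y_def)
    define h where "h = m powr - \<eta>"
    have h: "0 < h" "h \<le> 1"
      using m \<eta> by (auto simp: h_def powr_minus_divide ge_one_powr_ge_zero)
    have e: "0 < 1 / m" "1 / m \<le> 1 / 2" using m by (auto simp: field_simps)
    define u where "u = enn2real (smoothing g h (1 / m) m y)"
    have u_ge: "r \<le> u" if "ennreal r \<le> smoothing g h (1 / m) m y" for r
      unfolding u_def using that finite[OF h(1) e(1), of m y]
      by (metis enn2real_mono enn2real_ennreal enn2real_nonneg infinity_ennreal_def linear order_trans)
    have fx: "0 < x * f x" using x f(3) by simp
    have ln_le: "ln (x * f x / u) \<le> ln (x * f x) - ln r" if "0 < r" "r \<le> u" for r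
    proof -
      have "ln (x * f x / u) = ln (x * f x) - ln u" using that fx by (intro ln_divide_pos) auto
      moreover have "ln r \<le> ln u" using that by simp
      ultimately show ?thesis by linarith
    qed
    have "local_inf f \<delta> x \<le> f x" using x f \<delta> by (intro local_inf_le) auto
    then have lnL: "0 \<le> ln (f x / local_inf f \<delta> x)" using L by simp
    have lny: "\<bar>y\<bar> \<le> 1 + \<bar>y\<bar> powr p"
    proof (cases "\<bar>y\<bar> \<le> 1")
      case False
      then have "\<bar>y\<bar> powr 1 \<le> \<bar>y\<bar> powr p" using \<eta> by (intro powr_mono) (auto simp: p_def)
      then show ?thesis using False by simp
    qed (simp add: add_increasing2)
    have pw: "0 \<le> \<bar>y\<bar> powr p" by simp
    have "0 < u \<and> ln (x * f x / u) \<le> C + ln (f x / local_inf f \<delta> x) + \<bar>ln (x * f x)\<bar> + 17 * \<bar>y\<bar> powr p"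
    proof (cases "\<bar>y\<bar> \<le> m")
      case True
      define a where "a = min 1 (\<delta> / (4 * exp y))"
      have a: "0 < a" "a \<le> 1" using \<delta> by (auto simp: a_def)
      define b where "b = exp (y - 1) * local_inf f \<delta> x"
      have b: "0 < b" using L by (simp add: b_def)
      have "b \<le> g t" if "\<bar>y - t\<bar> \<le> a" for t
        unfolding b_def g using exp_near[OF a_def \<delta> that] L f(2) exp_y
        by (intro mult_mono local_inf_le) auto
      then have "ennreal (c * a * b) \<le> smoothing g h (1 / m) m y"
        unfolding c_def using True m a b by (intro smoothing_ge_near h e) auto
      then have cab: "c * a * b \<le> u" by (rule u_ge)
      have pos: "0 < c * a * b" using a b c by simp
      have ln_a: "- \<bar>ln (\<delta> / 4)\<bar> - \<bar>y\<bar> \<le> ln a"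
      proof (cases "\<delta> / (4 * exp y) \<le> 1")
        case True
        then have "ln a = ln (\<delta> / 4 / exp y)" by (simp add: a_def)
        also have "\<dots> = ln (\<delta> / 4) - y" using \<delta> by (subst ln_div) auto
        finally show ?thesis by linarith
      qed (simp add: a_def)
      have ln_b: "ln b = y - 1 + ln (local_inf f \<delta> x)" using L by (simp add: b_def ln_mult)
      have "ln (x * f x / u) \<le> ln (x * f x) - ln (c * a * b)" by (rule ln_le[OF pos cab])
      also have "\<dots> = (ln x + ln (f x)) - (ln c + ln a + ln b)"
        using a b c x f(3)[OF x] by (simp add: ln_mult)
      also have "\<dots> = ln (f x / local_inf f \<delta> x) + 1 - ln c - ln a"
        using L f(3)[OF x] by (simp add: ln_b ln_div flip: y_def)
      also have "\<dots> \<le> ln (f x / local_inf f \<delta> x) + 2 + \<bar>ln c\<bar> + \<bar>ln (\<delta> / 4)\<bar> + \<bar>y\<bar> powr p"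
        using ln_a lny by linarith
      finally have "ln (x * f x / u) \<le> C + ln (f x / local_inf f \<delta> x) + \<bar>ln (x * f x)\<bar> + 17 * \<bar>y\<bar> powr p"
        using pw abs_ge_zero[of "ln (b0 / 5)"] abs_ge_zero[of "ln (x * f x)"] unfolding C_def by linarith
      then show ?thesis using less_le_trans[OF pos cab] by blast
    next
      case False
      then have y: "1 \<le> \<bar>y\<bar>" "m \<le> \<bar>y\<bar>" using m by auto
      have far: "b0 / 5 * exp (- 16 * (y / h)\<^sup>2 - 1) \<le> u"
        using y m b0 by (intro u_ge smoothing_ge_far h e) auto
      have pos: "0 < b0 / 5 * exp (- 16 * (y / h)\<^sup>2 - 1)" using b0 by simp
      have "(y / h)\<^sup>2 = y\<^sup>2 * (1 / h)\<^sup>2" by (simp add: power_divide)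
      also have "1 / h = m powr \<eta>" using m by (simp add: h_def powr_minus_divide)
      also have "y\<^sup>2 * (m powr \<eta>)\<^sup>2 \<le> \<bar>y\<bar>\<^sup>2 * (\<bar>y\<bar> powr \<eta>)\<^sup>2"
        using y m \<eta> by (intro mult_mono[of "y\<^sup>2"] power_mono[of "m powr \<eta>"] powr_mono2) auto
      also have "\<bar>y\<bar>\<^sup>2 * (\<bar>y\<bar> powr \<eta>)\<^sup>2 = (\<bar>y\<bar> powr 1 * \<bar>y\<bar> powr \<eta>)\<^sup>2"
        using y by (simp add: power_mult_distrib)
      also have "\<dots> = \<bar>y\<bar> powr ((1 + \<eta>) + (1 + \<eta>))"
        by (simp only: power2_eq_square powr_add)
      also have "(1 + \<eta>) + (1 + \<eta>) = p" by (simp add: p_def)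
      finally have yh: "(y / h)\<^sup>2 \<le> \<bar>y\<bar> powr p" .
      have "ln (x * f x / u) \<le> ln (x * f x) - ln (b0 / 5 * exp (- 16 * (y / h)\<^sup>2 - 1))"
        by (rule ln_le[OF pos far])
      also have "\<dots> = ln (x * f x) - ln (b0 / 5) + 16 * (y / h)\<^sup>2 + 1"
        using b0 by (subst ln_mult) auto
      also have "\<dots> \<le> \<bar>ln (x * f x)\<bar> + \<bar>ln (b0 / 5)\<bar> + 16 * \<bar>y\<bar> powr p + 1"
        using yh by linarith
      finally have "ln (x * f x / u) \<le> C + ln (f x / local_inf f \<delta> x) + \<bar>ln (x * f x)\<bar> + 17 * \<bar>y\<bar> powr p"
        using pw lnL abs_ge_zero[of "ln c"] abs_ge_zero[of "ln (\<delta> / 4)"] unfolding C_def by linarith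
      then show ?thesis using less_le_trans[OF pos far] by blast
    qed
    then show ?thesis by (simp add: u_def y_def h_def)
  qed
  ultimately show ?thesis unfolding p_def by blast
qed

lemma set_integrable_nn_finite:
  assumes "set_integrable lborel A (f :: real \<Rightarrow> real)"
  shows "(\<integral>\<^sup>+x\<in>A. ennreal \<bar>f x\<bar> \<partial>lborel) < \<infinity>"
proof -
  have "(\<integral>\<^sup>+x. ennreal (norm (indicator A x *\<^sub>R f x)) \<partial>lborel) < \<infinity>"
    using assms unfolding set_integrable_def integrable_iff_bounded by simp
  also have "(\<integral>\<^sup>+x. ennreal (norm (indicator A x *\<^sub>R f x)) \<partial>lborel) = (\<integral>\<^sup>+x\<in>A. ennreal \<bar>f x\<bar> \<partial>lborel)"
    by (intro nn_integral_cong) (auto split: split_indicator)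
  finally show ?thesis .
qed

text \<open>As \<open>m \<rightarrow> \<infinity>\<close> the positive part of the logarithmic ratio tends to 0 pointwise by the lower limit
of the smoothing, and by dominated convergence its integral tends to 0 as well.\<close>

lemma exists_smoothing_close:
  assumes f: "continuous_on UNIV f" "\<And>t. 0 \<le> f t" "\<And>t. 0 < t \<Longrightarrow> 0 < f t"
    and int: "(\<integral>\<^sup>+x\<in>{0<..}. ennreal (f x) \<partial>lborel) = 1"
    and xlogx: "set_integrable lborel {0<..} (\<lambda>x. f x * ln (x * f x))"
    and \<delta>: "0 < \<delta>" "log_ratio_integral f (local_inf f \<delta>) < \<infinity>"
    and \<eta>: "0 < \<eta>" "set_integrable lborel {0<..} (\<lambda>x. f x * \<bar>ln x\<bar> powr (2 * (1 + \<eta>)))"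
    and g: "\<And>t. g t = exp t * f (exp t)"
    and \<epsilon>: "0 < \<epsilon>"
  shows "\<exists>h e m. 0 < h \<and> 0 < e \<and> e < 1 \<and>
    (AE x in lborel. 0 < x \<longrightarrow> 0 < enn2real (smoothing g h e m (ln x))) \<and>
    (\<integral>\<^sup>+x\<in>{0<..}. ennreal (f x * max 0 (ln (x * f x / enn2real (smoothing g h e m (ln x))))) \<partial>lborel) < ennreal \<epsilon>"
proof -
  have f_meas [measurable]: "f \<in> borel_measurable borel"
    using f(1) by (rule borel_measurable_continuous_onI)
  have g_meas: "g \<in> borel_measurable borel" unfolding g[abs_def] by measurable
  have g_nonneg: "0 \<le> g t" for t by (simp add: g f(2))
  have "(\<integral>\<^sup>+t. ennreal (g t) \<partial>lborel) = 1"
    using nn_integral_exp_substitution[OF f_meas] int by (simp add: g mult.commute)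
  note finite = smoothing_finite[OF g_meas g_nonneg this]
  define p where "p = 2 * (1 + \<eta>)"
  define L where "L x = (if 0 < x then local_inf f \<delta> x else 0)" for x
  have L_meas [measurable]: "L \<in> borel_measurable borel"
    unfolding L_def[abs_def] using f(2) \<delta>(1) by (rule local_inf_measurable)
  have L_bounds: "0 \<le> L x" "L x \<le> f x" if "0 < x" for x
    using that f \<delta>(1) by (auto simp: L_def intro!: local_inf_le local_inf_nonneg)
  have term_nonneg: "0 \<le> log_ratio_term (f x) (L x)" if "0 < x" for x
    using L_bounds[OF that] f(3)[OF that] by (auto simp: log_ratio_term_def)
  have KL_finite: "(\<integral>\<^sup>+x\<in>{0<..}. e2ennreal (log_ratio_term (f x) (L x)) \<partial>lborel) < \<infinity>"
  proof -
    have "log_ratio_integral f (local_inf f \<delta>) = log_ratio_integral f L"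
      by (intro log_ratio_integral_cong) (auto simp: L_def)
    also have "(\<integral>\<^sup>+x\<in>{0<..}. e2ennreal (- log_ratio_term (f x) (L x)) \<partial>lborel) = (\<integral>\<^sup>+x. 0 \<partial>(lborel :: real measure))"
      using term_nonneg by (intro nn_integral_cong) (auto simp: e2ennreal_neg split: split_indicator)
    then have "log_ratio_integral f L =
        enn2ereal (\<integral>\<^sup>+x\<in>{0<..}. e2ennreal (log_ratio_term (f x) (L x)) \<partial>lborel)"
      unfolding log_ratio_integral_def by (simp add: zero_ennreal.rep_eq)
    finally show ?thesis
      using \<delta>(2) by (metis enn2ereal_top infinity_ennreal_def less_irrefl less_top)
  qed
  (* where the local infimum vanishes the integrand is infinite *)
  have AE_L: "AE x in lborel. 0 < x \<longrightarrow> 0 < L x"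
  proof -
    have "AE x in lborel. e2ennreal (log_ratio_term (f x) (L x)) * indicator {0<..} x \<noteq> \<infinity>"
      using KL_finite by (intro nn_integral_PInf_AE) auto
    then show ?thesis
    proof eventually_elim
      case (elim x)
      show ?case
      proof (intro impI)
        assume x: "0 < x"
        then have "L x \<noteq> 0" using elim f(3)[OF x] by (auto simp: log_ratio_term_def)
        then show "0 < L x" using L_bounds(1)[OF x] by simp
      qed
    qed
  qed
  obtain C where C: "0 \<le> C" and dom: "\<And>m x. 2 \<le> m \<Longrightarrow> 0 < x \<Longrightarrow> 0 < local_inf f \<delta> x \<Longrightarrow>
    0 < enn2real (smoothing g (m powr - \<eta>) (1 / m) m (ln x)) \<and>
    ln (x * f x / enn2real (smoothing g (m powr - \<eta>) (1 / m) m (ln x))) \<le>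
      C + ln (f x / local_inf f \<delta> x) + \<bar>ln (x * f x)\<bar> + 17 * \<bar>ln x\<bar> powr p"
    using ln_ratio_smoothing_le[OF f int \<eta>(1) \<delta>(1) g] unfolding p_def by blast
  (* the shift by 2 makes e n = 1 / m n at most 1/2 for all n *)
  define m where "m n = real n + 2" for n
  define h where "h n = m n powr - \<eta>" for n
  define e where "e n = 1 / m n" for n
  have m: "2 \<le> m n" for n by (simp add: m_def)
  have h: "0 < h n" for n using m[of n] by (simp add: h_def)
  have e: "0 < e n" "e n < 1" for n using m[of n] by (auto simp: e_def)
  have m_lim: "filterlim m at_top sequentially"
    by (rule filterlim_at_top_mono[OF filterlim_real_sequentially]) (simp add: m_def)
  have h_lim: "h \<longlonglongrightarrow> 0"
    unfolding h_def using \<eta>(1) by (intro tendsto_neg_powr m_lim) auto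
  have e_lim: "e \<longlonglongrightarrow> 0"
    unfolding e_def by (intro tendsto_divide_0[OF tendsto_const] filterlim_at_top_imp_at_infinity m_lim)
  define u where "u n x = enn2real (smoothing g (h n) (e n) (m n) (ln x))" for n x
  note [measurable] = smoothing_measurable[OF g_meas]
  have u_meas [measurable]: "u n \<in> borel_measurable borel" for n
    unfolding u_def by measurable
  define w where "w x = (ennreal C * ennreal (f x) + e2ennreal (log_ratio_term (f x) (L x)) +
    ennreal \<bar>f x * ln (x * f x)\<bar> + 17 * ennreal \<bar>f x * \<bar>ln x\<bar> powr p\<bar>) * indicator {0<..} x" for x
  have w_meas [measurable]: "w \<in> borel_measurable lborel" unfolding w_def by measurable
  have w_finite: "(\<integral>\<^sup>+x. w x \<partial>lborel) < \<infinity>"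
  proof -
    have "(\<integral>\<^sup>+x. w x \<partial>lborel) = ennreal C * (\<integral>\<^sup>+x\<in>{0<..}. ennreal (f x) \<partial>lborel) +
      (\<integral>\<^sup>+x\<in>{0<..}. e2ennreal (log_ratio_term (f x) (L x)) \<partial>lborel) +
      (\<integral>\<^sup>+x\<in>{0<..}. ennreal \<bar>f x * ln (x * f x)\<bar> \<partial>lborel) +
      17 * (\<integral>\<^sup>+x\<in>{0<..}. ennreal \<bar>f x * \<bar>ln x\<bar> powr p\<bar> \<partial>lborel)"
      unfolding w_def by (simp add: distrib_right nn_integral_add nn_integral_cmult mult.assoc)
    then show ?thesis
      using int KL_finite set_integrable_nn_finite[OF xlogx] set_integrable_nn_finite[OF \<eta>(2)]
      by (simp add: p_def ennreal_mult_less_top)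
  qed
  have pos_u: "0 < u n x" if "0 < x" "0 < L x" for n x
    using dom[OF m that(1)] that by (simp add: u_def h_def e_def L_def)
  have bound: "ennreal (f x * max 0 (ln (x * f x / u n x))) \<le> w x" if "0 < x" "0 < L x" for n x
  proof -
    have "0 \<le> ln (f x / L x)" using L_bounds[OF that(1)] that by simp
    moreover have "ln (x * f x / u n x) \<le> C + ln (f x / L x) + \<bar>ln (x * f x)\<bar> + 17 * \<bar>ln x\<bar> powr p"
      using dom[OF m that(1)] that by (simp add: u_def h_def e_def L_def)
    ultimately have "f x * max 0 (ln (x * f x / u n x)) \<le>
        f x * (C + ln (f x / L x) + \<bar>ln (x * f x)\<bar> + 17 * \<bar>ln x\<bar> powr p)"
      using C f(2) by (intro mult_left_mono) auto
    also have "\<dots> = C * f x + f x * ln (f x / L x) + \<bar>f x * ln (x * f x)\<bar> + 17 * \<bar>f x * \<bar>ln x\<bar> powr p\<bar>"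
      using f(2)[of x] by (simp add: abs_mult algebra_simps)
    finally have "ennreal (f x * max 0 (ln (x * f x / u n x))) \<le> ennreal \<dots>" by (rule ennreal_leI)
    also have "\<dots> = w x"
      using that C f(2)[of x] f(3)[OF that(1)] \<open>0 \<le> ln (f x / L x)\<close>
      by (simp add: w_def log_ratio_term_def ennreal_plus ennreal_mult)
    finally show ?thesis .
  qed
  have lim: "(\<lambda>n. ennreal (f x * max 0 (ln (x * f x / u n x)))) \<longlonglongrightarrow> 0" if x: "0 < x" "0 < L x" for x
  proof -
    have gx: "g (ln x) = x * f x" "0 < x * f x" using x f(3) by (auto simp: g)
    have g_cont: "continuous_on UNIV g"
      unfolding g[abs_def] using f(1)
      by (intro continuous_intros continuous_on_compose2[OF f(1)]) auto
    have liminf: "ennreal (x * f x) \<le> liminf (\<lambda>n. smoothing g (h n) (e n) (m n) (ln x))"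
      using smoothing_liminf_ge[OF g_cont g_nonneg e e_lim h h_lim m_lim, of "ln x"] by (simp add: gx)
    have "(\<lambda>n. max 0 (ln (x * f x / u n x))) \<longlonglongrightarrow> 0"
    proof (rule tendstoI)
      fix r :: real assume "0 < r"
      have "ennreal (x * f x * exp (- r)) < ennreal (x * f x)"
        using gx(2) \<open>0 < r\<close> mult_strict_left_mono[of "exp (- r)" 1 "x * f x"]
        by (intro ennreal_lessI) simp_all
      also note liminf
      finally have "eventually (\<lambda>n. ennreal (x * f x * exp (- r)) < smoothing g (h n) (e n) (m n) (ln x)) sequentially"
        by (rule less_LiminfD)
      then show "eventually (\<lambda>n. dist (max 0 (ln (x * f x / u n x))) 0 < r) sequentially"
      proof eventually_elim
        case (elim n)
        have "smoothing g (h n) (e n) (m n) (ln x) = ennreal (u n x)"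
          unfolding u_def using finite[OF h e(1), of n n "m n" "ln x"] by simp
        then have "x * f x * exp (- r) < u n x"
          using elim gx by (simp add: ennreal_less_iff)
        then have "ln (x * f x * exp (- r)) < ln (u n x)"
          using gx pos_u[OF x] by simp
        then have "ln (x * f x / u n x) < r"
          using gx(2) pos_u[OF x, of n] by (simp only: ln_divide_pos ln_mult_pos exp_gt_zero ln_exp)
        then show ?case using \<open>0 < r\<close> by simp
      qed
    qed
    then have "(\<lambda>n. ennreal (f x * max 0 (ln (x * f x / u n x)))) \<longlonglongrightarrow> ennreal (f x * 0)"
      by (intro tendsto_ennrealI tendsto_intros)
    then show ?thesis by simp
  qed
  have "(\<lambda>n. \<integral>\<^sup>+x. ennreal (f x * max 0 (ln (x * f x / u n x))) * indicator {0<..} x \<partial>lborel)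
      \<longlonglongrightarrow> (\<integral>\<^sup>+x. 0 \<partial>(lborel :: real measure))"
  proof (rule nn_integral_dominated_convergence[where w=w])
    show "AE x in lborel. ennreal (f x * max 0 (ln (x * f x / u n x))) * indicator {0<..} x \<le> w x" for n
      using AE_L by eventually_elim (use bound in \<open>auto split: split_indicator\<close>)
    show "AE x in lborel. (\<lambda>n. ennreal (f x * max 0 (ln (x * f x / u n x))) * indicator {0<..} x) \<longlonglongrightarrow> 0"
      using AE_L by eventually_elim (use lim in \<open>auto split: split_indicator\<close>)
  qed (use w_finite in measurable)
  then have "eventually (\<lambda>n. (\<integral>\<^sup>+x\<in>{0<..}. ennreal (f x * max 0 (ln (x * f x / u n x))) \<partial>lborel) < ennreal \<epsilon>) sequentially"
    by (rule order_tendstoD(2)) (use \<epsilon> in simp)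
  then obtain n where "(\<integral>\<^sup>+x\<in>{0<..}. ennreal (f x * max 0 (ln (x * f x / u n x))) \<partial>lborel) < ennreal \<epsilon>"
    by (auto simp: eventually_sequentially)
  moreover have "AE x in lborel. 0 < x \<longrightarrow> 0 < u n x"
    using AE_L by eventually_elim (use pos_u in auto)
  ultimately show ?thesis
    using h e unfolding u_def by blast
qed

section \<open>The Kullback-Leibler property\<close>

text \<open>Dropping the negative part of the integrand only increases the divergence, so a pointwise lower
bound for \<open>F\<close> bounds it from above.\<close>

lemma log_ratio_integral_le:
  assumes f: "\<And>x. 0 < x \<Longrightarrow> 0 < f x"
    and F: "AE x in lborel. 0 < x \<longrightarrow> 0 < u x \<and> u x / x \<le> F x"
  shows "log_ratio_integral f F \<le>
    enn2ereal (\<integral>\<^sup>+x\<in>{0<..}. ennreal (f x * max 0 (ln (x * f x / u x))) \<partial>lborel)"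
proof -
  have "AE x in lborel. e2ennreal (log_ratio_term (f x) (F x)) * indicator {0<..} x \<le>
      ennreal (f x * max 0 (ln (x * f x / u x))) * indicator {0<..} x"
    using F
  proof eventually_elim
    case (elim x)
    show ?case
    proof (cases "0 < x")
      case True
      then have u: "0 < u x" "u x / x \<le> F x" "0 < u x / x" using elim by auto
      then have F: "0 < F x" by linarith
      have "f x / F x \<le> f x / (u x / x)"
        using f[OF True] u by (intro divide_left_mono mult_pos_pos F) auto
      moreover have "0 < f x / F x" "f x / (u x / x) = x * f x / u x"
        using f[OF True] F by (auto simp: mult.commute)
      ultimately have "ln (f x / F x) \<le> ln (x * f x / u x)"
        by (simp only: ln_mono)
      then have "f x * ln (f x / F x) \<le> f x * max 0 (ln (x * f x / u x))"
        using f[OF True] by (intro mult_left_mono) auto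
      then show ?thesis
        using F f[OF True] True by (auto simp: log_ratio_term_def intro!: ennreal_leI)
    qed simp
  qed
  then have "(\<integral>\<^sup>+x\<in>{0<..}. e2ennreal (log_ratio_term (f x) (F x)) \<partial>lborel) \<le>
      (\<integral>\<^sup>+x\<in>{0<..}. ennreal (f x * max 0 (ln (x * f x / u x))) \<partial>lborel)"
    by (rule nn_integral_mono_AE)
  moreover have "log_ratio_integral f F \<le>
      enn2ereal (\<integral>\<^sup>+x\<in>{0<..}. e2ennreal (log_ratio_term (f x) (F x)) \<partial>lborel)"
    unfolding log_ratio_integral_def by (intro ereal_diff_le_self) auto
  ultimately show ?thesis
    by (meson less_eq_ennreal.rep_eq order_trans)
qed

text \<open>The common core of both types: a random mixing measure that charges boxes comes close to a good
smoothing of \<open>f\<close> with positive probability.\<close>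

lemma random_mixture_in_KL:
  assumes L: "L \<in> measurable M (prob_algebra (restrict_space borel half_plane))"
    and F: "\<And>\<omega> x. \<omega> \<in> space M \<Longrightarrow> x > 0 \<Longrightarrow> F \<omega> x = mixture_I lognormal_kernel (L \<omega>) x"
    and charges: "charges_boxes M L"
    and f: "continuous_on UNIV f" "\<And>t. 0 \<le> f t" "\<And>t. 0 < t \<Longrightarrow> 0 < f t"
    and int: "(\<integral>\<^sup>+x\<in>{0<..}. ennreal (f x) \<partial>lborel) = 1"
    and xlogx: "set_integrable lborel {0<..} (\<lambda>x. f x * ln (x * f x))"
    and \<delta>: "0 < \<delta>" "log_ratio_integral f (local_inf f \<delta>) < \<infinity>"
    and \<eta>: "0 < \<eta>" "set_integrable lborel {0<..} (\<lambda>x. f x * \<bar>ln x\<bar> powr (2 * (1 + \<eta>)))"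
  shows "in_KL f (density_law M F)"
proof (rule in_KL_density_law[OF L F])
  show f_meas [measurable]: "f \<in> borel_measurable borel"
    using f(1) by (rule borel_measurable_continuous_onI)
  fix \<epsilon> :: real assume \<epsilon>: "0 < \<epsilon>"
  define g where "g t = exp t * f (exp t)" for t
  have g_meas [measurable]: "g \<in> borel_measurable borel" unfolding g_def by measurable
  have g_nonneg: "0 \<le> g t" for t by (simp add: g_def f(2))
  have g_int: "(\<integral>\<^sup>+t. ennreal (g t) \<partial>lborel) = 1"
    using nn_integral_exp_substitution[OF f_meas] int by (simp add: g_def mult.commute)
  obtain h e m where he: "0 < h" "0 < e" "e < 1"
    and pos: "AE x in lborel. 0 < x \<longrightarrow> 0 < enn2real (smoothing g h e m (ln x))"
    and close: "(\<integral>\<^sup>+x\<in>{0<..}. ennreal (f x * max 0 (ln (x * f x / enn2real (smoothing g h e m (ln x)))))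
      \<partial>lborel) < ennreal \<epsilon>"
    using exists_smoothing_close[OF f int xlogx \<delta> \<eta> g_def \<epsilon>] by blast
  define \<nu> where "\<nu> = density lborel (\<lambda>t. ennreal (g t))"
  have \<nu>: "prob_space \<nu>" "sets \<nu> = sets borel"
    by (auto simp: \<nu>_def emeasure_density g_int intro!: prob_spaceI)
  have LP: "L \<omega> \<in> prob_measures half_plane" if "\<omega> \<in> space M" for \<omega>
    using measurable_space[OF L that] .
  have smoothing_eq: "smoothing g h e m y =
      ennreal (1 - e) * (\<integral>\<^sup>+t\<in>{- m..m}. ennreal (shrunk_normal h e (y - t)) \<partial>\<nu>)" for y
    unfolding smoothing_def \<nu>_def
    by (subst nn_integral_density)
       (auto simp: ennreal_mult g_nonneg shrunk_normal_nonneg he mult.assoc)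
  obtain E where E: "E \<in> sets M" "0 < emeasure M E"
    and ge: "\<And>\<omega> x. \<omega> \<in> E \<Longrightarrow> 0 < x \<Longrightarrow>
      ennreal (1 / x) * smoothing g h e m (ln x) \<le> mixture_nn (L \<omega>) x"
    using charges_boxes_mixture_ge[OF charges LP \<nu> he, of m] unfolding smoothing_eq by blast
  show "\<exists>E\<in>sets M. 0 < emeasure M E \<and>
      (\<forall>\<omega>\<in>E. log_ratio_integral f (\<lambda>x. enn2real (mixture_nn (L \<omega>) x)) < ereal \<epsilon>)"
  proof (intro bexI[OF _ E(1)] conjI E(2) ballI)
    fix \<omega> assume \<omega>: "\<omega> \<in> E"
    then have "\<omega> \<in> space M" using sets.sets_into_space[OF E(1)] by auto
    have "log_ratio_integral f (\<lambda>x. enn2real (mixture_nn (L \<omega>) x)) \<le>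
      enn2ereal (\<integral>\<^sup>+x\<in>{0<..}. ennreal (f x * max 0 (ln (x * f x / enn2real (smoothing g h e m (ln x))))) \<partial>lborel)"
    proof (rule log_ratio_integral_le[OF f(3)])
      show "AE x in lborel. 0 < x \<longrightarrow> 0 < enn2real (smoothing g h e m (ln x)) \<and>
          enn2real (smoothing g h e m (ln x)) / x \<le> enn2real (mixture_nn (L \<omega>) x)"
        using pos AE_mixture_nn_finite[OF LP[OF \<open>\<omega> \<in> space M\<close>]]
      proof eventually_elim
        case (elim x)
        show ?case
        proof (intro impI conjI)
          assume x: "0 < x"
          then show "0 < enn2real (smoothing g h e m (ln x))" using elim by blast
          have "enn2real (ennreal (1 / x) * smoothing g h e m (ln x)) \<le> enn2real (mixture_nn (L \<omega>) x)"
            using elim x by (intro enn2real_mono ge \<omega>) auto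
          then show "enn2real (smoothing g h e m (ln x)) / x \<le> enn2real (mixture_nn (L \<omega>) x)"
            using x by (simp add: enn2real_mult)
        qed
      qed
    qed
    also have "\<dots> < enn2ereal (ennreal \<epsilon>)"
      using close by (simp add: less_ennreal.rep_eq)
    also have "\<dots> = ereal \<epsilon>" using \<epsilon> by simp
    finally show "log_ratio_integral f (\<lambda>x. enn2real (mixture_nn (L \<omega>) x)) < ereal \<epsilon>" .
  qed
qed

lemma restrict_space_borel_UNIV: "restrict_space borel UNIV = (borel :: 'a::topological_space measure)"
proof (rule measure_eqI)
  fix A :: "'a set" assume "A \<in> sets (restrict_space borel UNIV)"
  then show "emeasure (restrict_space borel UNIV) A = emeasure borel A"
    by (subst emeasure_restrict_space) auto
qed (simp add: sets_restrict_space)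

lemma distr_Pair_prob_measures:
  assumes Q: "prob_space Q" "sets Q = sets borel" and h: "0 < h"
  shows "(\<lambda>\<theta>. (\<theta>, h)) \<in> measurable Q (restrict_space borel half_plane)"
    "distr Q (restrict_space borel half_plane) (\<lambda>\<theta>. (\<theta>, h)) \<in> prob_measures half_plane"
proof -
  have "(\<lambda>\<theta>. (\<theta>, h)) \<in> measurable borel (borel :: (real \<times> real) measure)"
    by (intro borel_measurable_continuous_onI continuous_intros)
  then have "(\<lambda>\<theta>. (\<theta>, h)) \<in> measurable borel (restrict_space borel half_plane)"
    using h by (intro measurable_restrict_space2) auto
  then show meas: "(\<lambda>\<theta>. (\<theta>, h)) \<in> measurable Q (restrict_space borel half_plane)"
    by (subst measurable_cong_sets[OF Q(2) refl])
  show "distr Q (restrict_space borel half_plane) (\<lambda>\<theta>. (\<theta>, h)) \<in> prob_measures half_plane"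
    using prob_space.prob_space_distr[OF Q(1) meas] by (simp add: space_prob_algebra)
qed

text \<open>The measure \<open>Q \<otimes> \<delta>\<^sub>h\<close> on the half-plane satisfies the required lower bounds.\<close>

lemma type_I_charges_boxes:
  assumes prior: "is_prior (weak_topology half_plane) \<rho>"
    and supp: "measure_support (weak_topology half_plane) \<rho> = prob_measures half_plane"
  shows "charges_boxes \<rho> (\<lambda>P. P)"
  unfolding charges_boxes_def
proof (intro allI impI, elim conjE)
  fix Q :: "real measure" and K a and h s :: real
  assume Q: "prob_space Q" "sets Q = sets borel" and K: "finite K" and s: "0 < s" "s \<le> h"
    and a: "\<forall>\<theta>\<in>K. 0 \<le> a \<theta> \<and> a \<theta> < measure Q {\<theta>}"
  interpret Q: prob_space Q by fact
  have h: "0 < h" using s by linarith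
  let ?Q = "distr Q (restrict_space borel half_plane) (\<lambda>\<theta>. (\<theta>, h))"
  have box: "half_plane \<inter> (ball \<theta> s \<times> ball h s) = ball \<theta> s \<times> ball h s" for \<theta>
    using box_in_sets(1)[OF s(2), of \<theta>] by blast
  have "a \<theta> < measure ?Q (half_plane \<inter> (ball \<theta> s \<times> ball h s))" if "\<theta> \<in> K" for \<theta>
  proof -
    have "measure ?Q (ball \<theta> s \<times> ball h s) =
        measure Q ((\<lambda>\<theta>. (\<theta>, h)) -` (ball \<theta> s \<times> ball h s) \<inter> space Q)"
      by (rule measure_distr[OF distr_Pair_prob_measures(1)[OF Q h] box_in_sets(2)[OF s(2)]])
    also have "(\<lambda>\<theta>. (\<theta>, h)) -` (ball \<theta> s \<times> ball h s) \<inter> space Q = ball \<theta> s"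
      using s sets_eq_imp_space_eq[OF Q(2)] by auto
    also have "measure Q {\<theta>} \<le> measure Q (ball \<theta> s)"
      using s by (intro Q.finite_measure_mono) (auto simp: Q(2))
    finally show ?thesis unfolding box using a that by fastforce
  qed
  then have "0 < emeasure \<rho> {P \<in> space \<rho>. \<forall>\<theta>\<in>K. a \<theta> < measure P (half_plane \<inter> (ball \<theta> s \<times> ball h s))}"
    by (intro weak_prior_charges[OF prior supp distr_Pair_prob_measures(2)[OF Q h] K] open_Times) auto
  then show "0 < emeasure \<rho> {P \<in> space \<rho>. \<forall>\<theta>\<in>K. a \<theta> < measure P (ball \<theta> s \<times> ball h s)}"
    unfolding box .
qed

text \<open>A Type II mixture with parameters \<open>(P, \<phi>)\<close> is the Type I mixture with the mixing measure
\<open>P \<otimes> \<delta>\<^sub>\<phi>\<close>.\<close>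

definition product_mixing :: "real measure \<times> real \<Rightarrow> (real \<times> real) measure" where
  "product_mixing = (\<lambda>(P, \<phi>). distr P (restrict_space borel half_plane) (\<lambda>\<theta>. (\<theta>, \<phi>)))"

context
  fixes \<rho> :: "real measure measure" and \<mu> :: "real measure"
  assumes rho: "is_prior (weak_topology UNIV) \<rho>"
    and rho_supp: "measure_support (weak_topology UNIV) \<rho> = prob_measures UNIV"
    and mu: "is_prior (top_of_set {0<..}) \<mu>"
    and mu_supp: "measure_support (top_of_set {0<..}) \<mu> = {0<..}"
begin

lemma space_type_II: "space (\<rho> \<Otimes>\<^sub>M \<mu>) = prob_measures UNIV \<times> {0<..}"
  using is_priorD(3)[OF rho] is_priorD(3)[OF mu]
  by (simp add: space_pair_measure topspace_weak_topology)

lemma open_Int_in_sets_mu: "open U \<Longrightarrow> {0<..} \<inter> U \<in> sets \<mu>"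
  using openin_borel_of[of "top_of_set {0<..}" "{0<..} \<inter> U"]
  by (simp add: is_priorD(2)[OF mu] openin_open_Int)

lemma measurable_product_mixing:
  "product_mixing \<in> measurable (\<rho> \<Otimes>\<^sub>M \<mu>) (prob_algebra (restrict_space borel half_plane))"
proof -
  have id_mu [measurable]: "(\<lambda>\<phi>. \<phi>) \<in> measurable \<mu> borel"
  proof (rule borel_measurableI)
    fix U :: "real set" assume "open U"
    then show "(\<lambda>\<phi>. \<phi>) -` U \<inter> space \<mu> \<in> sets \<mu>"
      using open_Int_in_sets_mu[of U] is_priorD(3)[OF mu] by (simp add: Int_commute)
  qed
  have [measurable]: "(\<lambda>P. P) \<in> measurable \<rho> (prob_algebra borel)"
    using weak_prior_measurable[OF rho] by (simp add: restrict_space_borel_UNIV)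
  have "(\<lambda>z. (snd z, snd (fst z))) \<in> measurable ((\<rho> \<Otimes>\<^sub>M \<mu>) \<Otimes>\<^sub>M borel) (borel \<Otimes>\<^sub>M borel)"
    by measurable
  then have "(\<lambda>z. (snd z, snd (fst z))) \<in> measurable ((\<rho> \<Otimes>\<^sub>M \<mu>) \<Otimes>\<^sub>M borel) (borel :: (real \<times> real) measure)"
    by (simp add: borel_prod)
  then have pair: "(\<lambda>(w, \<theta>). (\<theta>, snd w)) \<in>
      measurable ((\<rho> \<Otimes>\<^sub>M \<mu>) \<Otimes>\<^sub>M borel) (restrict_space borel half_plane)"
    unfolding split_beta'
    by (intro measurable_restrict_space2)
       (auto simp: space_pair_measure is_priorD(3)[OF mu])
  have "(\<lambda>w. distr (fst w) (restrict_space borel half_plane) (\<lambda>\<theta>. (\<theta>, snd w)))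
      \<in> measurable (\<rho> \<Otimes>\<^sub>M \<mu>) (prob_algebra (restrict_space borel half_plane))"
    by (rule measurable_distr_prob_space2[OF _ pair]) measurable
  then show ?thesis by (simp add: product_mixing_def split_beta')
qed

lemma mixture_II_eq_mixture_I:
  assumes "w \<in> space (\<rho> \<Otimes>\<^sub>M \<mu>)"
  shows "mixture_II lognormal_kernel w x = mixture_I lognormal_kernel (product_mixing w) x"
proof -
  obtain P \<phi> where w: "w = (P, \<phi>)" "P \<in> prob_measures UNIV" "0 < \<phi>"
    using assms space_type_II by auto
  have P: "prob_space P" "sets P = sets borel"
    using prob_measuresD[OF w(2)] by (simp_all add: restrict_space_borel_UNIV)
  note [measurable] = measurable_fst_snd_half_plane
  have "(\<lambda>p. lognormal_kernel x (fst p) (snd p)) \<in> borel_measurable (restrict_space borel half_plane)"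
    unfolding lognormal_kernel_def by measurable
  then show ?thesis
    unfolding w(1) mixture_II_def mixture_I_def product_mixing_def
    using distr_Pair_prob_measures(1)[OF P w(3)] by (simp add: integral_distr)
qed

text \<open>By independence, the event that \<open>P\<close> charges the intervals around the centres and \<open>\<phi>\<close> is close to
\<open>h\<close> has positive probability, being a product of two such events.\<close>

lemma type_II_charges_boxes: "charges_boxes (\<rho> \<Otimes>\<^sub>M \<mu>) product_mixing"
  unfolding charges_boxes_def
proof (intro allI impI, elim conjE)
  fix Q :: "real measure" and K a and h s :: real
  assume Q: "prob_space Q" "sets Q = sets borel" and K: "finite K" and s: "0 < s" "s \<le> h"
    and a: "\<forall>\<theta>\<in>K. 0 \<le> a \<theta> \<and> a \<theta> < measure Q {\<theta>}"
  interpret Q: prob_space Q by fact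
  interpret mu: prob_space \<mu> using is_priorD(1)[OF mu] .
  have h: "0 < h" using s by linarith
  let ?A = "{P \<in> space \<rho>. \<forall>\<theta>\<in>K. a \<theta> < measure P (UNIV \<inter> ball \<theta> s)}"
  let ?B = "{0<..} \<inter> ball h s"
  have "a \<theta> < measure Q (UNIV \<inter> ball \<theta> s)" if "\<theta> \<in> K" for \<theta>
  proof -
    have "measure Q {\<theta>} \<le> measure Q (UNIV \<inter> ball \<theta> s)"
      using s by (intro Q.finite_measure_mono) (auto simp: Q(2))
    then show ?thesis using a that by fastforce
  qed
  moreover have "Q \<in> prob_measures UNIV"
    using Q by (simp add: space_prob_algebra restrict_space_borel_UNIV)
  ultimately have A: "0 < emeasure \<rho> ?A"
    by (intro weak_prior_charges[OF rho rho_supp _ K]) auto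
  have "openin (top_of_set {0<..}) ?B" by (simp add: openin_open_Int)
  moreover have "h \<in> measure_support (top_of_set {0<..}) \<mu>" "h \<in> ?B" using mu_supp h s by auto
  ultimately have B: "0 < emeasure \<mu> ?B" unfolding measure_support_def by blast
  have sets: "?A \<in> sets \<rho>" "?B \<in> sets \<mu>"
    using A emeasure_notin_sets[of ?A \<rho>] open_Int_in_sets_mu[of "ball h s"] by fastforce+
  have "0 < emeasure \<rho> ?A * emeasure \<mu> ?B" using A B by (simp add: ennreal_zero_less_mult_iff)
  also have "\<dots> = emeasure (\<rho> \<Otimes>\<^sub>M \<mu>) (?A \<times> ?B)"
    by (rule mu.emeasure_pair_measure_Times[symmetric, OF sets])
  also have "\<dots> \<le> emeasure (\<rho> \<Otimes>\<^sub>M \<mu>)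
      {w \<in> space (\<rho> \<Otimes>\<^sub>M \<mu>). \<forall>\<theta>\<in>K. a \<theta> < measure (product_mixing w) (ball \<theta> s \<times> ball h s)}"
  proof (rule emeasure_mono)
    have "(\<lambda>w. measure (product_mixing w) (ball \<theta> s \<times> ball h s)) \<in> borel_measurable (\<rho> \<Otimes>\<^sub>M \<mu>)" for \<theta>
      by (rule measurable_compose[OF measurable_product_mixing])
         (rule measurable_measure_prob_algebra[OF box_in_sets(2)[OF s(2)]])
    then show "{w \<in> space (\<rho> \<Otimes>\<^sub>M \<mu>). \<forall>\<theta>\<in>K. a \<theta> < measure (product_mixing w) (ball \<theta> s \<times> ball h s)}
        \<in> sets (\<rho> \<Otimes>\<^sub>M \<mu>)"
      using K by measurable
    show "?A \<times> ?B \<subseteq>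
        {w \<in> space (\<rho> \<Otimes>\<^sub>M \<mu>). \<forall>\<theta>\<in>K. a \<theta> < measure (product_mixing w) (ball \<theta> s \<times> ball h s)}"
    proof (intro subsetI CollectI conjI ballI)
      fix w assume w: "w \<in> ?A \<times> ?B"
      then obtain P \<phi> where P\<phi>: "w = (P, \<phi>)" "P \<in> ?A" "\<phi> \<in> ?B" by blast
      show sp: "w \<in> space (\<rho> \<Otimes>\<^sub>M \<mu>)"
        using P\<phi> is_priorD(3)[OF mu] by (auto simp: space_pair_measure)
      fix \<theta> assume "\<theta> \<in> K"
      have P: "P \<in> prob_measures UNIV" using sp P\<phi>(1) space_type_II by simp
      have P': "prob_space P" "sets P = sets borel" "space P = UNIV"
        using prob_measuresD[OF P] by (simp_all add: restrict_space_borel_UNIV)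
      have "\<phi> > 0" using P\<phi> by auto
      have "measure (product_mixing w) (ball \<theta> s \<times> ball h s) =
          measure P ((\<lambda>\<theta>. (\<theta>, \<phi>)) -` (ball \<theta> s \<times> ball h s) \<inter> space P)"
        unfolding P\<phi>(1) product_mixing_def split
        by (rule measure_distr[OF distr_Pair_prob_measures(1)[OF P'(1,2) \<open>\<phi> > 0\<close>] box_in_sets(2)[OF s(2)]])
      also have "(\<lambda>\<theta>. (\<theta>, \<phi>)) -` (ball \<theta> s \<times> ball h s) \<inter> space P = UNIV \<inter> ball \<theta> s"
        using P\<phi>(3) P'(3) by auto
      finally show "a \<theta> < measure (product_mixing w) (ball \<theta> s \<times> ball h s)"
        using P\<phi>(2) \<open>\<theta> \<in> K\<close> by simp
    qed
  qed
  finally show "0 < emeasure (\<rho> \<Otimes>\<^sub>M \<mu>)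
      {w \<in> space (\<rho> \<Otimes>\<^sub>M \<mu>). \<forall>\<theta>\<in>K. a \<theta> < measure (product_mixing w) (ball \<theta> s \<times> ball h s)}" .
qed

end

theorem theorem12:
  fixes f0 :: "real \<Rightarrow> real" and Pi_star :: "(real \<Rightarrow> real) measure"
  assumes prior:
    "(\<exists>\<rho>. is_prior (weak_topology (UNIV \<times> {0<..})) \<rho> \<and>
          measure_support (weak_topology (UNIV \<times> {0<..})) \<rho> = prob_measures (UNIV \<times> {0<..}) \<and>
          Pi_star = type_I_prior lognormal_kernel \<rho>) \<or>
     (\<exists>\<rho> \<mu>. is_prior (weak_topology UNIV) \<rho> \<and>
          measure_support (weak_topology UNIV) \<rho> = prob_measures UNIV \<and>
          is_prior (top_of_set {0<..}) \<mu> \<and>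
          measure_support (top_of_set {0<..}) \<mu> = {0<..} \<and>
          Pi_star = type_II_prior lognormal_kernel \<rho> \<mu>)"
  and f0_cont: "continuous_on {0..} f0"
  and f0_nonneg: "\<And>x. x \<ge> 0 \<Longrightarrow> f0 x \<ge> 0"
  and f0_density: "(\<integral>\<^sup>+x\<in>{0..}. ennreal (f0 x) \<partial>lborel) = 1"
  and f0_nonzero: "\<And>x. x > 0 \<Longrightarrow> f0 x \<noteq> 0"
  and f0_bounded: "\<exists>M. \<forall>x\<ge>0. f0 x \<le> M"
  and cond2: "set_integrable lborel {0<..} (\<lambda>x. f0 x * ln (x * f0 x))"
  and cond3: "\<exists>\<delta>>0. log_ratio_integral f0 (local_inf f0 \<delta>) < \<infinity>"
  and cond4: "\<exists>\<eta>>0. set_integrable lborel {0<..} (\<lambda>x. f0 x * \<bar>ln x\<bar> powr (2 * (1 + \<eta>)))"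
  shows "in_KL f0 Pi_star"
proof -
  (* a continuous, hence measurable, function on the whole line that agrees with f0 where it matters *)
  define f where "f x = f0 (max 0 x)" for x
  have f_eq: "f x = f0 x" if "0 \<le> x" for x using that by (simp add: f_def)
  have f_cont: "continuous_on UNIV f"
    unfolding f_def by (intro continuous_on_compose2[OF f0_cont] continuous_intros) auto
  have f_nonneg: "0 \<le> f x" for x using f0_nonneg by (simp add: f_def)
  have f_pos: "0 < f x" if "0 < x" for x
    using f0_nonneg[of x] f0_nonzero[OF that] that by (simp add: f_eq)
  have "(\<integral>\<^sup>+x\<in>{0<..}. ennreal (f x) \<partial>lborel) = (\<integral>\<^sup>+x\<in>{0..}. ennreal (f0 x) \<partial>lborel)"
    using AE_lborel_singleton[of 0]
    by (intro nn_integral_cong_AE, eventually_elim) (auto simp: f_eq split: split_indicator)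
  then have f_int: "(\<integral>\<^sup>+x\<in>{0<..}. ennreal (f x) \<partial>lborel) = 1" using f0_density by simp
  have xlogx: "set_integrable lborel {0<..} (\<lambda>x. f x * ln (x * f x))"
    using cond2 by (subst set_integrable_cong[OF refl]) (auto simp: f_eq)
  obtain \<delta> where \<delta>: "0 < \<delta>" "log_ratio_integral f0 (local_inf f0 \<delta>) < \<infinity>" using cond3 by blast
  have "local_inf f \<delta> = local_inf f0 \<delta>"
    unfolding local_inf_def by (intro ext INF_cong refl) (auto simp: f_eq)
  then have \<delta>': "log_ratio_integral f (local_inf f \<delta>) < \<infinity>"
    using \<delta>(2) log_ratio_integral_cong[of f f0 "local_inf f \<delta>" "local_inf f0 \<delta>"] by (simp add: f_eq)
  obtain \<eta> where \<eta>: "0 < \<eta>" "set_integrable lborel {0<..} (\<lambda>x. f0 x * \<bar>ln x\<bar> powr (2 * (1 + \<eta>)))"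
    using cond4 by blast
  have \<eta>': "set_integrable lborel {0<..} (\<lambda>x. f x * \<bar>ln x\<bar> powr (2 * (1 + \<eta>)))"
    using \<eta>(2) by (subst set_integrable_cong[OF refl]) (auto simp: f_eq)
  note KL = random_mixture_in_KL[OF _ _ _ f_cont f_nonneg f_pos f_int xlogx \<delta>(1) \<delta>' \<eta>(1) \<eta>']
  have "in_KL f Pi_star"
    using prior
  proof (elim disjE exE conjE)
    fix \<rho> assume *: "is_prior (weak_topology half_plane) \<rho>"
      "measure_support (weak_topology half_plane) \<rho> = prob_measures half_plane"
      "Pi_star = type_I_prior lognormal_kernel \<rho>"
    show ?thesis
      unfolding *(3) type_I_prior_def
      by (rule KL[OF weak_prior_measurable[OF *(1)] refl type_I_charges_boxes[OF *(1,2)]])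
  next
    fix \<rho> \<mu> assume *: "is_prior (weak_topology UNIV) \<rho>"
      "measure_support (weak_topology UNIV) \<rho> = prob_measures UNIV"
      "is_prior (top_of_set {0<..}) \<mu>" "measure_support (top_of_set {0<..}) \<mu> = {0<..}"
      "Pi_star = type_II_prior lognormal_kernel \<rho> \<mu>"
    show ?thesis
      unfolding *(5) type_II_prior_def
      by (rule KL[OF measurable_product_mixing[OF *(1-4)] mixture_II_eq_mixture_I[OF *(1-4)]
            type_II_charges_boxes[OF *(1-4)]])
  qed
  moreover have "log_ratio_integral f F = log_ratio_integral f0 F" for F
    by (intro log_ratio_integral_cong) (auto simp: f_eq)
  ultimately show ?thesis unfolding in_KL_def by simp
qed

end
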